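(* Let $|\phi|<1$, $|\rho|<1$, $\sigma_\xi>0$, and let $(Y_t)_{t\ge 0}$ be a Markov DIG-AR(1) process with parameters $\phi,\rho,\sigma_\xi$. For $T\ge 2$ let $$\hat\phi_T=\frac{\sum_{t=2}^{T}Y_tY_{t-1}}{\sum_{t=2}^{T}Y_{t-1}^2}$$ be the OLS estimator of $\phi$. Then $\hat\phi_T$ is not a consistent estimator of $\phi$; in particular, as $T\to+\infty$, $$\hat\phi_T\longrightarrow \bar\tau(\rho,\phi)=\phi+\frac{\rho\,\sigma_\xi}{\bar V(\rho,\phi)}\quad\text{almost surely},$$ where $$\bar V(\rho,\phi)=\frac{\sigma_\xi\left(\rho\phi+\sqrt{\rho^2\phi^2+1-\phi^2}\right)}{1-\phi^2}.$$
   Context: A dependent innovations gaussian AR(1) process (DIG-AR(1)) with parameters $\phi,\rho,\sigma_\xi$ ($|\phi|<1$, $|\rho|<1$, $\sigma_\xi>0$) is a discrete-time real stochastic process on a probability space, $Y_t=\phi Y_{t-1}+\xi_t$ for $t\ge 1$, where $Y_0=0$ a.s., the $\xi_t$ are identically distributed (not assumed independent) with $\xi_t\sim N(0,\sigma_\xi^2)$ (variance $\sigma_\xi^2$), and for every $t$ the copula associated with $(\xi_t,Y_{t-1})$ is the gaussian copula with time-invariant parameter (correlation) $\rho$. For $t=1$ the copula condition is no restriction because $Y_0$ is constant. It is called a Markov DIG-AR(1) process if moreover $(Y_t)_t$ is a Markov process with respect to its own filtration. The quantity $\bar V(\rho,\phi)$ is the limit, as $t\to+\infty$, of the standard deviation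 $V_t$ of $Y_t$, and $\bar\tau(\rho,\phi)$ is the limit, as $t\to+\infty$, of the correlation between $Y_t$ and $Y_{t+1}$.
   Formalization: The claim that the OLS estimator is not consistent is proved only for ρ ≠ 0; for ρ = 0 it is false, since then the almost sure limit τ̄ equals φ. The limits of the standard deviation, the correlation and the estimator are proved for all |ρ| < 1. *)

theory Defs
  imports "HOL-Probability.Probability"
begin

definition std_normal_quantile :: "real \<Rightarrow> ereal" where
  "std_normal_quantile u = (INF z\<in>{z. u \<le> cdf std_normal_distribution z}. ereal z)"
  \<comment> \<open>the generalized inverse of the standard normal distribution function; it is \<open>ereal\<close>-valued
    so that the end points \<open>u = 0\<close> and \<open>u = 1\<close> are sent to \<open>-\<infinity>\<close> and \<open>\<infinity>\<close>\<close>

definition bivariate_std_normal_density :: "real \<Rightarrow> real \<times> real \<Rightarrow> real" where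
  "bivariate_std_normal_density r = (\<lambda>(x, y).
     exp (- (x\<^sup>2 - 2 * r * x * y + y\<^sup>2) / (2 * (1 - r\<^sup>2))) / (2 * pi * sqrt (1 - r\<^sup>2)))"

definition bivariate_std_normal_cdf :: "real \<Rightarrow> ereal \<Rightarrow> ereal \<Rightarrow> real" where
  "bivariate_std_normal_cdf r a b =
     measure (density lborel (bivariate_std_normal_density r)) {(x, y). ereal x \<le> a \<and> ereal y \<le> b}"

definition gaussian_copula :: "real \<Rightarrow> real \<Rightarrow> real \<Rightarrow> real" where
  "gaussian_copula r u v =
     bivariate_std_normal_cdf r (std_normal_quantile u) (std_normal_quantile v)"

definition correlation :: "'a measure \<Rightarrow> ('a \<Rightarrow> real) \<Rightarrow> ('a \<Rightarrow> real) \<Rightarrow> real" where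
  "correlation M X Y =
     (LINT \<omega>|M. (X \<omega> - (LINT \<omega>'|M. X \<omega>')) * (Y \<omega> - (LINT \<omega>'|M. Y \<omega>')))
       / (sqrt (prob_space.variance M X) * sqrt (prob_space.variance M Y))"

definition natural_filtration :: "'a measure \<Rightarrow> (nat \<Rightarrow> 'a \<Rightarrow> real) \<Rightarrow> nat \<Rightarrow> 'a measure" where
  "natural_filtration M Y t =
     sigma (space M) (\<Union>s\<le>t. {Y s -` A \<inter> space M | A. A \<in> sets borel})"

definition converges_in_probability ::
    "'a measure \<Rightarrow> (nat \<Rightarrow> 'a \<Rightarrow> real) \<Rightarrow> real \<Rightarrow> bool" where
  "converges_in_probability M X c \<longleftrightarrow>
     (\<forall>\<epsilon>>0. (\<lambda>n. measure M {\<omega> \<in> space M. \<bar>X n \<omega> - c\<bar> > \<epsilon>}) \<longlonglongrightarrow> 0)"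

context prob_space
begin

definition has_copula :: "('a \<Rightarrow> real) \<Rightarrow> ('a \<Rightarrow> real) \<Rightarrow> (real \<Rightarrow> real \<Rightarrow> real) \<Rightarrow> bool" where
  "has_copula X Y C \<longleftrightarrow> (\<forall>x y. prob {\<omega> \<in> space M. X \<omega> \<le> x \<and> Y \<omega> \<le> y} =
     C (cdf (distr M borel X) x) (cdf (distr M borel Y) y))"
  \<comment> \<open>Sklar's relation; used below only for functions \<open>C\<close> that are copulas\<close>

definition markov_process :: "(nat \<Rightarrow> 'a \<Rightarrow> real) \<Rightarrow> bool" where
  "markov_process Y \<longleftrightarrow> (\<forall>t. random_variable borel (Y t)) \<and>
     (\<forall>s t. s \<le> t \<longrightarrow> (\<forall>A \<in> sets borel. AE \<omega> in M.
        real_cond_exp M (natural_filtration M Y s) (\<lambda>\<omega>. indicator A (Y t \<omega>)) \<omega> =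
        real_cond_exp M (vimage_algebra (space M) (Y s) borel) (\<lambda>\<omega>. indicator A (Y t \<omega>)) \<omega>))"

end

locale DIG_AR1 = prob_space M for M :: "'a measure" +
  fixes Y \<xi> :: "nat \<Rightarrow> 'a \<Rightarrow> real" and \<phi> \<rho> \<sigma> :: real
  assumes phi: "\<bar>\<phi>\<bar> < 1" and rho: "\<bar>\<rho>\<bar> < 1" and sigma: "\<sigma> > 0"
    and Y_measurable: "\<And>t. random_variable borel (Y t)"
    and Y_0: "AE \<omega> in M. Y 0 \<omega> = 0"
    and Y_step: "\<And>t. t \<ge> 1 \<Longrightarrow> AE \<omega> in M. Y t \<omega> = \<phi> * Y (t - 1) \<omega> + \<xi> t \<omega>"
    and innovation: "\<And>t. t \<ge> 1 \<Longrightarrow> distributed M lborel (\<xi> t) (normal_density 0 \<sigma>)"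
      \<comment> \<open>the second parameter of \<^const>\<open>normal_density\<close> is the standard deviation\<close>
    and copula: "\<And>t. t \<ge> 1 \<Longrightarrow> has_copula (\<xi> t) (Y (t - 1)) (gaussian_copula \<rho>)"
      \<comment> \<open>no restriction for \<open>t = 1\<close>: the distribution function of \<open>Y 0\<close> takes only the values
        \<open>0\<close> and \<open>1\<close>, and \<open>C(u, 0) = 0\<close>, \<open>C(u, 1) = u\<close> for every copula \<open>C\<close>\<close>

locale markov_DIG_AR1 = DIG_AR1 +
  assumes markov: "markov_process Y"

definition ols_estimator :: "(nat \<Rightarrow> 'a \<Rightarrow> real) \<Rightarrow> nat \<Rightarrow> 'a \<Rightarrow> real" where
  "ols_estimator Y T \<omega> =
     (\<Sum>t=2..T. Y t \<omega> * Y (t - 1) \<omega>) / (\<Sum>t=2..T. (Y (t - 1) \<omega>)\<^sup>2)"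

end

theory Submission
  imports Defs "HOL-Library.Discrete_Functions"
begin

text \<open>Put \<open>V\<^sub>0 = \<sigma>\<close> and write \<open>V\<^sub>n\<close> for the standard deviation of \<open>Y (n + 1)\<close>. If \<open>Y (n + 1)\<close>
  is normal, the copula condition makes \<open>(\<xi> (n + 2), Y (n + 1))\<close> jointly normal with correlation \<open>\<rho>\<close>.
  Regressing the innovation on \<open>Y (n + 1)\<close> leaves a standard normal residual \<open>e\<^sub>n\<close> that is independent
  of \<open>Y (n + 1)\<close>, and so
  \<open>Y (n + 2) = a\<^sub>n * Y (n + 1) + s * e\<^sub>n\<close> with \<open>a\<^sub>n = \<phi> + \<rho> * \<sigma> / V\<^sub>n\<close> and \<open>s = \<sigma> * sqrt (1 - \<rho>\<^sup>2)\<close>.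
  Hence \<open>Y (n + 2)\<close> is normal again, and \<open>V\<close> is the orbit of \<open>\<sigma>\<close> under
  \<open>v \<mapsto> sqrt ((\<phi> * v + \<rho> * \<sigma>)\<^sup>2 + s\<^sup>2)\<close>. This map contracts by the factor \<open>\<bar>\<phi>\<bar>\<close> and the limit in the
  theorem is its fixed point (\<open>stdev_tendsto\<close>). So \<open>a\<^sub>n\<close> converges to \<open>\<tau> = \<phi> + \<rho> * \<sigma> / V\<close>, and \<open>\<tau>\<close>
  is also the limit of the correlations \<open>a\<^sub>n * V\<^sub>n / V\<^bsub>n+1\<^esub>\<close>.

  The Markov property upgrades the independence of \<open>e\<^sub>n\<close> from \<open>Y (n + 1)\<close> to independence from the
  whole past (\<open>markov_innovation_indep_past\<close>). Therefore the sequences \<open>e\<^sub>n * Y (n + 1)\<close>,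
  \<open>a\<^sub>n * e\<^sub>n * Y (n + 1)\<close> and \<open>e\<^sub>n\<^sup>2 - 1\<close> are orthogonal in \<open>L\<^sup>2\<close> with bounded norms, and their averages
  tend to \<open>0\<close> almost surely (\<open>orthogonal_strong_law\<close>).

  What remains is a statement about single trajectories (\<open>ols_ratio_tendsto\<close>). The estimator minus
  \<open>\<tau>\<close> is a weighted mean of the numbers \<open>a\<^sub>n - \<tau>\<close>, with weights \<open>Y (n + 1)\<^sup>2\<close>, plus the quotient of
  \<open>s * (\<Sum>n. e\<^sub>n * Y (n + 1))\<close> by \<open>\<Sum>n. Y (n + 1)\<^sup>2\<close>. The denominator grows at least linearly, because
  squaring the recursion and dropping \<open>(a\<^sub>n * Y (n + 1))\<^sup>2\<close> bounds \<open>Y (n + 2)\<^sup>2\<close> below by terms whose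
  averages converge to \<open>s\<^sup>2\<close>; hence both terms vanish. If \<open>\<rho> \<noteq> 0\<close> then
  \<open>\<tau> \<noteq> \<phi>\<close>, and an almost sure limit \<open>\<tau>\<close> excludes convergence in probability to \<open>\<phi>\<close>.\<close>

section \<open>A strong law for orthogonal sequences\<close>

text \<open>By monotone convergence the sum of all \<open>Z n\<close> has finite expectation, so it is finite almost
  everywhere and its terms vanish.\<close>

lemma AE_tendsto_0_of_summable_expectation:
  fixes Z :: "nat \<Rightarrow> 'a \<Rightarrow> real"
  assumes int: "\<And>n. integrable M (Z n)" and nonneg: "\<And>n \<omega>. 0 \<le> Z n \<omega>"
    and sm: "summable (\<lambda>n. LINT \<omega>|M. Z n \<omega>)"
  shows "AE \<omega> in M. (\<lambda>n. Z n \<omega>) \<longlonglongrightarrow> 0"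
proof -
  have [measurable]: "Z n \<in> borel_measurable M" for n using int by auto
  have "(\<integral>\<^sup>+\<omega>. (\<Sum>n. ennreal (Z n \<omega>)) \<partial>M) = (\<Sum>n. \<integral>\<^sup>+\<omega>. ennreal (Z n \<omega>) \<partial>M)"
    by (rule nn_integral_suminf) simp
  also have "\<dots> = (\<Sum>n. ennreal (LINT \<omega>|M. Z n \<omega>))"
    using int nonneg by (simp add: nn_integral_eq_integral)
  also have "\<dots> \<noteq> \<infinity>"
    using sm nonneg by (simp add: suminf_ennreal2 Bochner_Integration.integral_nonneg)
  finally have "AE \<omega> in M. (\<Sum>n. ennreal (Z n \<omega>)) \<noteq> \<infinity>"
    by (intro nn_integral_noteq_infinite) auto
  then show ?thesis
  proof eventually_elim
    case (elim \<omega>)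
    then have "summable (\<lambda>n. Z n \<omega>)" using nonneg by (intro summable_suminf_not_top) auto
    then show ?case by (rule summable_LIMSEQ_zero)
  qed
qed

lemma integrable_mult_of_squares:
  fixes X Z :: "'a \<Rightarrow> real"
  assumes [measurable]: "X \<in> borel_measurable M" "Z \<in> borel_measurable M"
    and "integrable M (\<lambda>\<omega>. (X \<omega>)\<^sup>2)" "integrable M (\<lambda>\<omega>. (Z \<omega>)\<^sup>2)"
  shows "integrable M (\<lambda>\<omega>. X \<omega> * Z \<omega>)"
proof (rule Bochner_Integration.integrable_bound)
  show "integrable M (\<lambda>\<omega>. (X \<omega>)\<^sup>2 + (Z \<omega>)\<^sup>2)" using assms by simp
  show "AE \<omega> in M. norm (X \<omega> * Z \<omega>) \<le> norm ((X \<omega>)\<^sup>2 + (Z \<omega>)\<^sup>2)"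
  proof (intro AE_I2)
    fix \<omega>
    have "2 * \<bar>X \<omega>\<bar> * \<bar>Z \<omega>\<bar> \<le> (X \<omega>)\<^sup>2 + (Z \<omega>)\<^sup>2"
      using sum_squares_bound[of "\<bar>X \<omega>\<bar>" "\<bar>Z \<omega>\<bar>"] by simp
    moreover have "0 \<le> \<bar>X \<omega>\<bar> * \<bar>Z \<omega>\<bar>" by simp
    ultimately have "\<bar>X \<omega>\<bar> * \<bar>Z \<omega>\<bar> \<le> (X \<omega>)\<^sup>2 + (Z \<omega>)\<^sup>2" by linarith
    then show "norm (X \<omega> * Z \<omega>) \<le> norm ((X \<omega>)\<^sup>2 + (Z \<omega>)\<^sup>2)"
      by (simp add: abs_mult)
  qed
qed measurable

lemma sum_square_orthogonal:
  fixes X :: "'i \<Rightarrow> 'a \<Rightarrow> real"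
  assumes [measurable]: "\<And>i. X i \<in> borel_measurable M"
    and sq: "\<And>i. integrable M (\<lambda>\<omega>. (X i \<omega>)\<^sup>2)"
    and orth: "\<And>i j. i \<noteq> j \<Longrightarrow> (LINT \<omega>|M. X i \<omega> * X j \<omega>) = 0"
    and "finite I"
  shows "integrable M (\<lambda>\<omega>. (\<Sum>i\<in>I. X i \<omega>)\<^sup>2)"
    and "(LINT \<omega>|M. (\<Sum>i\<in>I. X i \<omega>)\<^sup>2) = (\<Sum>i\<in>I. LINT \<omega>|M. (X i \<omega>)\<^sup>2)"
proof -
  have int: "integrable M (\<lambda>\<omega>. X i \<omega> * X j \<omega>)" for i j
    by (intro integrable_mult_of_squares sq) measurable
  have eq: "(\<Sum>i\<in>I. X i \<omega>)\<^sup>2 = (\<Sum>i\<in>I. \<Sum>j\<in>I. X i \<omega> * X j \<omega>)" for \<omega>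
    by (simp add: power2_eq_square sum_product)
  show "integrable M (\<lambda>\<omega>. (\<Sum>i\<in>I. X i \<omega>)\<^sup>2)"
    unfolding eq by (intro Bochner_Integration.integrable_sum int)
  have "(LINT \<omega>|M. (\<Sum>i\<in>I. X i \<omega>)\<^sup>2) = (\<Sum>i\<in>I. \<Sum>j\<in>I. LINT \<omega>|M. X i \<omega> * X j \<omega>)"
    unfolding eq by (simp add: int)
  also have "\<dots> = (\<Sum>i\<in>I. \<Sum>j\<in>I. if i = j then LINT \<omega>|M. (X i \<omega>)\<^sup>2 else 0)"
    by (intro sum.cong refl) (auto simp: orth power2_eq_square)
  also have "\<dots> = (\<Sum>i\<in>I. LINT \<omega>|M. (X i \<omega>)\<^sup>2)"
    using \<open>finite I\<close> by simp
  finally show "(LINT \<omega>|M. (\<Sum>i\<in>I. X i \<omega>)\<^sup>2) = (\<Sum>i\<in>I. LINT \<omega>|M. (X i \<omega>)\<^sup>2)" .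
qed

text \<open>Orthogonality bounds the second moment of the \<open>N\<close>-th partial sum by \<open>N * C\<close>. Along the squares
  \<open>N = n\<^sup>2\<close> the second moments of the averages are then at most \<open>C / n\<^sup>2\<close>, which is summable. Between
  \<open>n\<^sup>2\<close> and \<open>(n + 1)\<^sup>2\<close> only \<open>2 * n + 1\<close> terms are added, so Cauchy--Schwarz alone bounds their
  contribution, divided by \<open>n\<^sup>2\<close>, by a variable whose second moment is of order \<open>1 / n\<^sup>2\<close>.\<close>

lemma orthogonal_strong_law:
  fixes X :: "nat \<Rightarrow> 'a \<Rightarrow> real"
  assumes [measurable]: "\<And>i. X i \<in> borel_measurable M"
    and sq: "\<And>i. integrable M (\<lambda>\<omega>. (X i \<omega>)\<^sup>2)"
    and orth: "\<And>i j. i < j \<Longrightarrow> (LINT \<omega>|M. X i \<omega> * X j \<omega>) = 0"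
    and bound: "\<And>i. (LINT \<omega>|M. (X i \<omega>)\<^sup>2) \<le> C"
  shows "AE \<omega> in M. (\<lambda>N. (\<Sum>i<N. X i \<omega>) / real N) \<longlonglongrightarrow> 0"
proof -
  have orth': "(LINT \<omega>|M. X i \<omega> * X j \<omega>) = 0" if "i \<noteq> j" for i j
    using orth[of i j] orth[of j i] that by (cases i j rule: linorder_cases) (auto simp: mult.commute)
  have C: "0 \<le> C" using bound[of 0] by (meson Bochner_Integration.integral_nonneg order_trans zero_le_power2)
  \<comment> \<open>\<open>S\<close> is the squared average at \<open>n\<^sup>2\<close>, and \<open>D\<close> dominates the squared increment over the next block divided by \<open>n ^ 4\<close>; both are \<open>0\<close> for \<open>n = 0\<close>\<close>
  define S where "S n \<omega> = (\<Sum>i<n\<^sup>2. X i \<omega>)\<^sup>2 / real n ^ 4" for n \<omega>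
  define D where "D n \<omega> = (\<Sum>i\<in>{n\<^sup>2..<(Suc n)\<^sup>2}. (X i \<omega>)\<^sup>2) * real (2 * n + 1) / real n ^ 4" for n \<omega>
  have card: "card {n\<^sup>2..<(Suc n)\<^sup>2} = 2 * n + 1" for n
    by (simp add: power2_eq_square)
  have inv_sq: "summable (\<lambda>n. c * (1 / real n ^ 2))" for c
    using inverse_power_summable[of 2, where 'a=real] by (intro summable_mult) (simp add: inverse_eq_divide)

  have "AE \<omega> in M. (\<lambda>n. S n \<omega>) \<longlonglongrightarrow> 0"
  proof (rule AE_tendsto_0_of_summable_expectation)
    show "integrable M (S n)" for n
      unfolding S_def using sum_square_orthogonal(1)[OF assms(1) sq orth', where I = "{..<n\<^sup>2}"] by simp
    show "0 \<le> S n \<omega>" for n \<omega> by (simp add: S_def)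
    show "summable (\<lambda>n. LINT \<omega>|M. S n \<omega>)"
    proof (rule summable_comparison_test[OF _ inv_sq[of C]], intro exI allI impI)
      fix n :: nat
      have "(LINT \<omega>|M. S n \<omega>) = (\<Sum>i<n\<^sup>2. LINT \<omega>|M. (X i \<omega>)\<^sup>2) / real n ^ 4"
        unfolding S_def using sum_square_orthogonal[OF assms(1) sq orth', where I = "{..<n\<^sup>2}"] by simp
      also have "\<dots> \<le> (real n ^ 2 * C) / real n ^ 4"
        using sum_bounded_above[of "{..<n\<^sup>2}" "\<lambda>i. LINT \<omega>|M. (X i \<omega>)\<^sup>2" C] bound
        by (intro divide_right_mono) auto
      also have "\<dots> = C * (1 / real n ^ 2)" by (simp add: field_simps eval_nat_numeral)
      finally show "norm (LINT \<omega>|M. S n \<omega>) \<le> C * (1 / real n ^ 2)"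
        by (simp add: S_def)
    qed
  qed
  moreover have "AE \<omega> in M. (\<lambda>n. D n \<omega>) \<longlonglongrightarrow> 0"
  proof (rule AE_tendsto_0_of_summable_expectation)
    show "integrable M (D n)" for n
      unfolding D_def using sq by simp
    show "0 \<le> D n \<omega>" for n \<omega> by (auto simp: D_def intro!: divide_nonneg_nonneg mult_nonneg_nonneg sum_nonneg)
    then have nn: "0 \<le> (LINT \<omega>|M. D n \<omega>)" for n by simp
    show "summable (\<lambda>n. LINT \<omega>|M. D n \<omega>)"
    proof (rule summable_comparison_test[OF _ inv_sq[of "9 * C"]], intro exI allI impI)
      fix n :: nat
      have "(LINT \<omega>|M. D n \<omega>)
          = (\<Sum>i\<in>{n\<^sup>2..<(Suc n)\<^sup>2}. LINT \<omega>|M. (X i \<omega>)\<^sup>2) * real (2 * n + 1) / real n ^ 4"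
        unfolding D_def using sq by simp
      also have "\<dots> \<le> (real (2 * n + 1) * C) * real (2 * n + 1) / real n ^ 4"
        using sum_bounded_above[of "{n\<^sup>2..<(Suc n)\<^sup>2}" "\<lambda>i. LINT \<omega>|M. (X i \<omega>)\<^sup>2" C, unfolded card] bound
        by (intro divide_right_mono mult_right_mono) auto
      also have "\<dots> \<le> 9 * C * (1 / real n ^ 2)"
      proof (cases "n = 0")
        case False
        then have "real (2 * n + 1) ^ 2 \<le> (3 * real n) ^ 2" by (intro power_mono) auto
        then have "C * real (2 * n + 1) ^ 2 \<le> C * (3 * real n) ^ 2" using C by (intro mult_left_mono)
        then have "C * real (2 * n + 1) ^ 2 / real n ^ 4 \<le> C * (3 * real n) ^ 2 / real n ^ 4"
          by (intro divide_right_mono) auto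
        then show ?thesis using False by (simp add: power2_eq_square eval_nat_numeral field_simps)
      qed simp
      finally show "norm (LINT \<omega>|M. D n \<omega>) \<le> 9 * C * (1 / real n ^ 2)"
        using nn by simp
    qed
  qed
  ultimately show ?thesis
  proof eventually_elim
    case (elim \<omega>)
    have "(\<lambda>n. sqrt (S n \<omega>) + sqrt (D n \<omega>)) \<longlonglongrightarrow> sqrt 0 + sqrt 0"
      using elim by (intro tendsto_intros)
    moreover have "filterlim floor_sqrt at_top sequentially"
      unfolding filterlim_at_top
      by (metis eventually_sequentially le_floor_sqrtI order_refl le_floor_sqrt_iff le_trans)
    ultimately have lim: "(\<lambda>N. sqrt (S (floor_sqrt N) \<omega>) + sqrt (D (floor_sqrt N) \<omega>)) \<longlonglongrightarrow> 0"
      by (auto dest: filterlim_compose)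
    show ?case
    proof (rule Lim_null_comparison[OF _ lim], rule eventually_sequentiallyI[of 1])
      fix N :: nat assume N: "1 \<le> N"
      define n where "n = floor_sqrt N"
      have n: "1 \<le> n" "n\<^sup>2 \<le> N" "N < (Suc n)\<^sup>2"
        using N Suc_floor_sqrt_power2_gt[of N] le_floor_sqrtI[of 1 N] by (auto simp: n_def)
      let ?J = "{n\<^sup>2..<(Suc n)\<^sup>2}"
      have "(\<Sum>i<N. X i \<omega>) = (\<Sum>i<n\<^sup>2. X i \<omega>) + (\<Sum>i\<in>{n\<^sup>2..<N}. X i \<omega>)"
        using n by (metis atLeast0LessThan sum.atLeastLessThan_concat zero_le)
      also have "\<bar>\<dots>\<bar> \<le> \<bar>\<Sum>i<n\<^sup>2. X i \<omega>\<bar> + (\<Sum>i\<in>?J. \<bar>X i \<omega>\<bar>)"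
      proof -
        have "\<bar>\<Sum>i\<in>{n\<^sup>2..<N}. X i \<omega>\<bar> \<le> (\<Sum>i\<in>{n\<^sup>2..<N}. \<bar>X i \<omega>\<bar>)" by (rule sum_abs)
        also have "\<dots> \<le> (\<Sum>i\<in>?J. \<bar>X i \<omega>\<bar>)" using n by (intro sum_mono2) auto
        finally show ?thesis by linarith
      qed
      finally have "\<bar>\<Sum>i<N. X i \<omega>\<bar> / real N
          \<le> (\<bar>\<Sum>i<n\<^sup>2. X i \<omega>\<bar> + (\<Sum>i\<in>?J. \<bar>X i \<omega>\<bar>)) / (real n)\<^sup>2"
        using n N by (intro frac_le) (auto intro!: add_nonneg_nonneg sum_nonneg simp flip: of_nat_power)
      also have "\<dots> = sqrt (S n \<omega>) + (\<Sum>i\<in>?J. \<bar>X i \<omega>\<bar>) / (real n)\<^sup>2"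
      proof -
        have "sqrt (real n ^ 4) = (real n)\<^sup>2" by (rule real_sqrt_unique) (simp_all add: power2_eq_square eval_nat_numeral)
        then show ?thesis by (simp add: S_def real_sqrt_divide add_divide_distrib)
      qed
      also have "(\<Sum>i\<in>?J. \<bar>X i \<omega>\<bar>) / (real n)\<^sup>2 \<le> sqrt (D n \<omega>)"
      proof (rule real_le_rsqrt)
        have "(\<Sum>i\<in>?J. \<bar>X i \<omega>\<bar>)\<^sup>2 \<le> (\<Sum>i\<in>?J. (X i \<omega>)\<^sup>2) * real (2 * n + 1)"
          using sum_squared_le_sum_of_squares[of "\<lambda>i. \<bar>X i \<omega>\<bar>" ?J] by (simp only: card) simp
        then have "(\<Sum>i\<in>?J. \<bar>X i \<omega>\<bar>)\<^sup>2 / real n ^ 4 \<le> D n \<omega>"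
          unfolding D_def by (intro divide_right_mono) auto
        then show "((\<Sum>i\<in>?J. \<bar>X i \<omega>\<bar>) / (real n)\<^sup>2)\<^sup>2 \<le> D n \<omega>"
          by (simp add: power_divide)
      qed
      finally show "norm ((\<Sum>i<N. X i \<omega>) / real N) \<le> sqrt (S (floor_sqrt N) \<omega>) + sqrt (D (floor_sqrt N) \<omega>)"
        by (simp add: n_def)
    qed
  qed
qed

section \<open>The least squares ratio along a single trajectory\<close>

lemma weighted_mean_tendsto_0:
  fixes b w :: "nat \<Rightarrow> real"
  assumes b: "b \<longlonglongrightarrow> 0" and w: "\<And>n. 0 \<le> w n"
    and W: "filterlim (\<lambda>N. \<Sum>n<N. w n) at_top sequentially"
  shows "(\<lambda>N. (\<Sum>n<N. b n * w n) / (\<Sum>n<N. w n)) \<longlonglongrightarrow> 0"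
proof (rule LIMSEQ_I)
  fix \<epsilon> :: real assume "0 < \<epsilon>"
  then obtain K where K: "\<And>n. K \<le> n \<Longrightarrow> \<bar>b n\<bar> < \<epsilon> / 2"
    using LIMSEQ_D[OF b, of "\<epsilon> / 2"] by auto
  define c where "c = \<bar>\<Sum>n<K. b n * w n\<bar>"
  have "eventually (\<lambda>N. 2 * c / \<epsilon> + 1 \<le> (\<Sum>n<N. w n)) sequentially"
    using W by (simp add: filterlim_at_top)
  then obtain N0 where N0: "\<And>N. N0 \<le> N \<Longrightarrow> 2 * c / \<epsilon> + 1 \<le> (\<Sum>n<N. w n)"
    by (auto simp: eventually_sequentially)
  have "norm ((\<Sum>n<N. b n * w n) / (\<Sum>n<N. w n) - 0) < \<epsilon>" if N: "max K N0 \<le> N" for N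
  proof -
    have big: "2 * c / \<epsilon> + 1 \<le> (\<Sum>n<N. w n)" using N N0 by simp
    have "0 \<le> 2 * c / \<epsilon>" using \<open>0 < \<epsilon>\<close> by (simp add: c_def)
    with big have pos: "0 < (\<Sum>n<N. w n)" by linarith
    have "2 * c / \<epsilon> < (\<Sum>n<N. w n)" using big by linarith
    then have c: "c < \<epsilon> / 2 * (\<Sum>n<N. w n)" using \<open>0 < \<epsilon>\<close> by (simp add: field_simps)
    have "(\<Sum>n<N. b n * w n) = (\<Sum>n<K. b n * w n) + (\<Sum>n\<in>{K..<N}. b n * w n)"
      using N by (metis atLeast0LessThan max.boundedE sum.atLeastLessThan_concat zero_le)
    also have "\<bar>\<dots>\<bar> \<le> c + \<bar>\<Sum>n\<in>{K..<N}. b n * w n\<bar>" unfolding c_def by (rule abs_triangle_ineq)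
    also have "\<bar>\<Sum>n\<in>{K..<N}. b n * w n\<bar> \<le> (\<Sum>n\<in>{K..<N}. \<epsilon> / 2 * w n)"
      by (rule order_trans[OF sum_abs]) (auto simp: abs_mult w simp del: times_divide_eq_left intro!: sum_mono mult_right_mono less_imp_le[OF K])
    also have "\<dots> \<le> (\<Sum>n<N. \<epsilon> / 2 * w n)"
      using w \<open>0 < \<epsilon>\<close> by (intro sum_mono2) auto
    also have "c + \<dots> < \<epsilon> * (\<Sum>n<N. w n)" using c by (simp only: sum_distrib_left[symmetric])
    finally show ?thesis using pos by (simp add: divide_less_eq)
  qed
  then show "\<exists>no. \<forall>n\<ge>no. norm ((\<Sum>n<n. b n * w n) / (\<Sum>n<n. w n) - 0) < \<epsilon>" by blast
qed

text \<open>The ratio is \<open>\<tau>\<close> plus a drift term, which is a weighted mean of \<open>a n - \<tau>\<close>, plus a noise term. Both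
  tend to \<open>0\<close> as soon as the sum of squares in the denominator grows at least linearly. That growth
  comes from the innovations: \<open>y (Suc n)\<^sup>2 \<ge> 2 * s * a n * e n * y n + s\<^sup>2 * (e n)\<^sup>2\<close>, where the mean of
  the first summand tends to \<open>0\<close> and that of the second to \<open>s\<^sup>2\<close>.\<close>

lemma ols_ratio_tendsto:
  fixes a y e :: "nat \<Rightarrow> real"
  assumes step: "\<And>n. y (Suc n) = a n * y n + s * e n" and s: "0 < s" and a: "a \<longlonglongrightarrow> \<tau>"
    and ey: "(\<lambda>N. (\<Sum>n<N. e n * y n) / real N) \<longlonglongrightarrow> 0"
    and aey: "(\<lambda>N. (\<Sum>n<N. a n * (e n * y n)) / real N) \<longlonglongrightarrow> 0"
    and ee: "(\<lambda>N. (\<Sum>n<N. (e n)\<^sup>2 - 1) / real N) \<longlonglongrightarrow> 0"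
  shows "(\<lambda>N. (\<Sum>n<N. y (Suc n) * y n) / (\<Sum>n<N. (y n)\<^sup>2)) \<longlonglongrightarrow> \<tau>"
proof -
  define Q where "Q N = (\<Sum>n<N. (y n)\<^sup>2)" for N
  \<comment> \<open>the mean of the lower bounds for \<open>y (Suc n)\<^sup>2\<close>\<close>
  define R where "R N = 2 * s * ((\<Sum>n<N. a n * (e n * y n)) / real N)
      + s\<^sup>2 * ((\<Sum>n<N. (e n)\<^sup>2 - 1) / real N) + s\<^sup>2" for N
  have Q_ge: "real N * R N \<le> Q (Suc N)" if "0 < N" for N
  proof -
    have "real N * R N = (\<Sum>n<N. 2 * s * (a n * (e n * y n)) + s\<^sup>2 * ((e n)\<^sup>2 - 1) + s\<^sup>2)"
      using that by (simp add: R_def sum.distrib distrib_left sum_distrib_left[symmetric])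
    also have "\<dots> \<le> (\<Sum>n<N. (y (Suc n))\<^sup>2)"
    proof (rule sum_mono)
      fix n
      have "0 \<le> (a n * y n)\<^sup>2" by simp
      then show "2 * s * (a n * (e n * y n)) + s\<^sup>2 * ((e n)\<^sup>2 - 1) + s\<^sup>2 \<le> (y (Suc n))\<^sup>2"
        unfolding step by (simp add: power2_eq_square algebra_simps)
    qed
    also have "\<dots> \<le> Q (Suc N)"
      unfolding Q_def by (subst sum.lessThan_Suc_shift) simp
    finally show ?thesis .
  qed
  have "R \<longlonglongrightarrow> 2 * s * 0 + s\<^sup>2 * 0 + s\<^sup>2"
    unfolding R_def by (intro tendsto_intros aey ee)
  then have "eventually (\<lambda>N. s\<^sup>2 / 2 < R N) sequentially"
    using s by (intro order_tendstoD(1)) auto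
  with eventually_gt_at_top[of 0] have "eventually (\<lambda>N. s\<^sup>2 / 4 * real (Suc N) \<le> Q (Suc N)) sequentially"
  proof eventually_elim
    case (elim N)
    have "s\<^sup>2 / 4 * real (Suc N) \<le> s\<^sup>2 / 4 * (2 * real N)" using elim by (intro mult_left_mono) auto
    also have "\<dots> = real N * (s\<^sup>2 / 2)" by simp
    also have "\<dots> \<le> real N * R N" using elim by (intro mult_left_mono) auto
    also have "\<dots> \<le> Q (Suc N)" using elim Q_ge by simp
    finally show ?case .
  qed
  then have Q_lin: "eventually (\<lambda>N. s\<^sup>2 / 4 * real N \<le> Q N) sequentially"
    by (subst (asm) eventually_sequentially_Suc)
  have "filterlim (\<lambda>N. s\<^sup>2 / 4 * real N) at_top sequentially"
    using s by (intro filterlim_tendsto_pos_mult_at_top[OF tendsto_const] filterlim_real_sequentially) auto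
  then have Q_top: "filterlim Q at_top sequentially"
    using Q_lin by (rule filterlim_at_top_mono)
  have noise: "(\<lambda>N. s * ((\<Sum>n<N. e n * y n) / Q N)) \<longlonglongrightarrow> 0"
  proof (rule Lim_null_comparison)
    show "(\<lambda>N. s * (4 / s\<^sup>2 * \<bar>(\<Sum>n<N. e n * y n) / real N\<bar>)) \<longlonglongrightarrow> 0"
      using tendsto_mult[OF tendsto_const[of s] tendsto_mult[OF tendsto_const[of "4 / s\<^sup>2"] tendsto_rabs[OF ey]]]
      by simp
    show "eventually (\<lambda>N. norm (s * ((\<Sum>n<N. e n * y n) / Q N))
        \<le> s * (4 / s\<^sup>2 * \<bar>(\<Sum>n<N. e n * y n) / real N\<bar>)) sequentially"
      using Q_lin eventually_gt_at_top[of 0]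
    proof eventually_elim
      case (elim N)
      have pos: "0 < s\<^sup>2 / 4 * real N" using elim s by simp
      have "\<bar>\<Sum>n<N. e n * y n\<bar> / Q N \<le> \<bar>\<Sum>n<N. e n * y n\<bar> / (s\<^sup>2 / 4 * real N)"
        using elim pos by (intro divide_left_mono mult_pos_pos) auto
      then have "s * (\<bar>\<Sum>n<N. e n * y n\<bar> / Q N) \<le> s * (\<bar>\<Sum>n<N. e n * y n\<bar> / (s\<^sup>2 / 4 * real N))"
        using s by (intro mult_left_mono) auto
      moreover have "0 \<le> Q N" by (simp add: Q_def sum_nonneg)
      ultimately show ?case using s by (simp add: abs_mult field_simps)
    qed
  qed
  have drift: "(\<lambda>N. (\<Sum>n<N. (a n - \<tau>) * (y n)\<^sup>2) / Q N) \<longlonglongrightarrow> 0"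
    using a Q_top unfolding Q_def by (intro weighted_mean_tendsto_0) (auto simp: LIM_zero)
  have "eventually (\<lambda>N. (\<Sum>n<N. y (Suc n) * y n) / Q N
      = \<tau> + (\<Sum>n<N. (a n - \<tau>) * (y n)\<^sup>2) / Q N + s * ((\<Sum>n<N. e n * y n) / Q N)) sequentially"
    using filterlim_at_top_dense[THEN iffD1, OF Q_top, rule_format, of 0]
  proof eventually_elim
    case (elim N)
    have "(\<Sum>n<N. y (Suc n) * y n) = (\<Sum>n<N. \<tau> * (y n)\<^sup>2 + (a n - \<tau>) * (y n)\<^sup>2 + s * (e n * y n))"
      by (intro sum.cong refl) (simp add: step power2_eq_square algebra_simps)
    also have "\<dots> = \<tau> * Q N + (\<Sum>n<N. (a n - \<tau>) * (y n)\<^sup>2) + s * (\<Sum>n<N. e n * y n)"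
      by (simp add: Q_def sum.distrib sum_distrib_left)
    finally show ?case using elim by (simp add: field_simps)
  qed
  moreover have "(\<lambda>N. \<tau> + (\<Sum>n<N. (a n - \<tau>) * (y n)\<^sup>2) / Q N + s * ((\<Sum>n<N. e n * y n) / Q N))
      \<longlonglongrightarrow> \<tau> + 0 + 0"
    by (intro tendsto_intros drift noise)
  ultimately have "(\<lambda>N. (\<Sum>n<N. y (Suc n) * y n) / Q N) \<longlonglongrightarrow> \<tau>"
    by (simp add: tendsto_cong)
  then show ?thesis by (simp add: Q_def)
qed

section \<open>Pairs of normal variables joined by a Gaussian copula\<close>

text \<open>Strict monotonicity makes the generalized inverse a true left inverse, so that the Gaussian copula
  evaluated at normal distribution functions is the bivariate normal distribution function.\<close>

lemma cdf_std_normal_strict_mono: "strict_mono (cdf std_normal_distribution)"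
proof (rule strict_monoI)
  fix x y :: real assume "x < y"
  interpret N: prob_space std_normal_distribution by (rule prob_space_normal_density) simp
  have pos: "std_normal_density z \<noteq> 0" for z using normal_density_pos[of 1 0 z] by simp
  have "N.prob {x<..y} \<noteq> 0"
  proof
    assume "N.prob {x<..y} = 0"
    then have "emeasure std_normal_distribution {x<..y} = 0" by (simp add: N.emeasure_eq_measure)
    then have "(\<integral>\<^sup>+z. ennreal (std_normal_density z) * indicator {x<..y} z \<partial>lborel) = 0"
      by (simp add: emeasure_density)
    then have "AE z in lborel. ennreal (std_normal_density z) * indicator {x<..y} z = 0"
      by (subst (asm) nn_integral_0_iff_AE) auto
    then have "AE z in lborel. z \<notin> {x<..y}"
      by eventually_elim (auto simp: pos split: split_indicator_asm)
    then have "{x<..y} \<in> null_sets lborel"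
      by (subst AE_iff_null_sets) auto
    with \<open>x < y\<close> show False by (simp add: null_sets_def)
  qed
  then have "0 < N.prob {x<..y}" by (simp add: zero_less_measure_iff)
  moreover have "cdf std_normal_distribution y - cdf std_normal_distribution x = N.prob {x<..y}"
    using \<open>x < y\<close> N.finite_measure_axioms
    by (intro finite_borel_measure.cdf_diff_eq finite_borel_measure.intro finite_borel_measure_axioms.intro) auto
  ultimately show "cdf std_normal_distribution x < cdf std_normal_distribution y" by linarith
qed

lemma std_normal_quantile_cdf: "std_normal_quantile (cdf std_normal_distribution z) = ereal z"
proof -
  have "{w. cdf std_normal_distribution z \<le> cdf std_normal_distribution w} = {z..}"
    using strict_mono_less_eq[OF cdf_std_normal_strict_mono] by auto
  then have "std_normal_quantile (cdf std_normal_distribution z) = (INF w\<in>{z..}. ereal w)"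
    by (simp add: std_normal_quantile_def)
  also have "\<dots> = ereal z" by (intro antisym INF_greatest) (auto intro: INF_lower)
  finally show ?thesis .
qed

lemma (in prob_space) cdf_distr_normal:
  assumes X: "distributed M lborel X (normal_density 0 s)" and s: "0 < s"
  shows "cdf (distr M borel X) x = cdf std_normal_distribution (x / s)"
proof -
  have [measurable]: "random_variable borel X" using distributed_measurable[OF X] by simp
  have "distributed M lborel (\<lambda>\<omega>. X \<omega> / s) std_normal_density"
    using normal_standard_normal_convert[OF s, of X 0] X by simp
  then have "std_normal_distribution = distr M lborel (\<lambda>\<omega>. X \<omega> / s)"
    by (simp add: distributed_distr_eq_density)
  then show ?thesis
    using s by (auto simp: cdf_def measure_distr divide_le_cancel intro!: arg_cong[where f=prob])
qed

text \<open>Completing the square: given the second coordinate \<open>y\<close>, the first one is normal with mean \<open>r * y\<close>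
  and variance \<open>1 - r\<^sup>2\<close>.\<close>

lemma bivariate_density_factor:
  assumes "\<bar>r\<bar> < 1"
  shows "bivariate_std_normal_density r (x, y)
    = std_normal_density y * normal_density (r * y) (sqrt (1 - r\<^sup>2)) x"
proof -
  have pos: "0 < 1 - r\<^sup>2" using assms by (simp add: abs_square_less_1)
  have "- y\<^sup>2 / 2 - (x - r * y)\<^sup>2 / (2 * (1 - r\<^sup>2)) = - (x\<^sup>2 - 2 * r * x * y + y\<^sup>2) / (2 * (1 - r\<^sup>2))"
    using pos by (simp add: field_simps) algebra
  then have "exp (- y\<^sup>2 / 2) * exp (- (x - r * y)\<^sup>2 / (2 * (1 - r\<^sup>2)))
      = exp (- (x\<^sup>2 - 2 * r * x * y + y\<^sup>2) / (2 * (1 - r\<^sup>2)))"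
    by (simp flip: exp_add)
  moreover have "sqrt (2 * pi) * sqrt (2 * pi * (1 - r\<^sup>2)) = 2 * pi * sqrt (1 - r\<^sup>2)"
    unfolding real_sqrt_mult[of "2 * pi"] by (simp flip: mult.assoc)
  ultimately show ?thesis
    using pos by (simp add: bivariate_std_normal_density_def normal_density_def)
qed

lemma measurable_bivariate_density [measurable]:
  "bivariate_std_normal_density r \<in> borel_measurable borel"
  unfolding bivariate_std_normal_density_def borel_prod[symmetric] by measurable

lemma nn_integral_normal_density_affine:
  fixes f :: "real \<Rightarrow> ennreal"
  assumes [measurable]: "f \<in> borel_measurable borel" and q: "0 < q"
  shows "(\<integral>\<^sup>+x. normal_density m q x * f x \<partial>lborel) = (\<integral>\<^sup>+w. std_normal_density w * f (m + q * w) \<partial>lborel)"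
proof -
  have "(\<integral>\<^sup>+x. normal_density m q x * f x \<partial>lborel)
      = ennreal \<bar>q\<bar> * (\<integral>\<^sup>+w. normal_density m q (m + q * w) * f (m + q * w) \<partial>lborel)"
    using q by (intro nn_integral_real_affine) auto
  also have "\<dots> = (\<integral>\<^sup>+w. ennreal \<bar>q\<bar> * (normal_density m q (m + q * w) * f (m + q * w)) \<partial>lborel)"
    by (subst nn_integral_cmult) auto
  also have "\<dots> = (\<integral>\<^sup>+w. std_normal_density w * f (m + q * w) \<partial>lborel)"
  proof (rule nn_integral_cong)
    fix w
    have "q * normal_density m q (m + q * w) = std_normal_density w"
      using q by (simp add: normal_density_def real_sqrt_mult power_mult_distrib)
    then show "ennreal \<bar>q\<bar> * (normal_density m q (m + q * w) * f (m + q * w)) = std_normal_density w * f (m + q * w)"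
      using q by (simp add: mult.assoc[symmetric] ennreal_mult[symmetric])
  qed
  finally show ?thesis .
qed

text \<open>In other words, the bivariate normal law is the law of \<open>(r * y + sqrt (1 - r\<^sup>2) * w, y)\<close> for
  independent standard normal \<open>y\<close> and \<open>w\<close>.\<close>

lemma nn_integral_bivariate_normal:
  fixes f :: "real \<times> real \<Rightarrow> ennreal"
  assumes [measurable]: "f \<in> borel_measurable borel" and r: "\<bar>r\<bar> < 1"
  shows "(\<integral>\<^sup>+p. f p \<partial>density lborel (bivariate_std_normal_density r)) =
    (\<integral>\<^sup>+y. std_normal_density y * (\<integral>\<^sup>+w. std_normal_density w * f (r * y + sqrt (1 - r\<^sup>2) * w, y) \<partial>lborel) \<partial>lborel)"
proof -
  have pos: "0 < 1 - r\<^sup>2" using r by (simp add: abs_square_less_1)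
  have [measurable]: "f \<in> borel_measurable (borel \<Otimes>\<^sub>M borel)" by (simp add: borel_prod)
  have [measurable]: "bivariate_std_normal_density r \<in> borel_measurable (borel \<Otimes>\<^sub>M borel)"
    by (simp add: borel_prod)
  have "(\<integral>\<^sup>+p. f p \<partial>density lborel (bivariate_std_normal_density r))
      = (\<integral>\<^sup>+p. bivariate_std_normal_density r p * f p \<partial>lborel)"
    by (subst nn_integral_density) auto
  also have "\<dots> = (\<integral>\<^sup>+p. bivariate_std_normal_density r p * f p \<partial>(lborel \<Otimes>\<^sub>M lborel))"
    by (simp add: lborel_prod)
  also have "\<dots> = (\<integral>\<^sup>+y. \<integral>\<^sup>+x. bivariate_std_normal_density r (x, y) * f (x, y) \<partial>lborel \<partial>lborel)"
    by (rule lborel_pair.nn_integral_snd[symmetric]) measurable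
  also have "\<dots> = (\<integral>\<^sup>+y. \<integral>\<^sup>+x. std_normal_density y * (normal_density (r * y) (sqrt (1 - r\<^sup>2)) x * f (x, y)) \<partial>lborel \<partial>lborel)"
    by (simp add: bivariate_density_factor[OF r] ennreal_mult mult.assoc)
  also have "\<dots> = (\<integral>\<^sup>+y. std_normal_density y * (\<integral>\<^sup>+x. normal_density (r * y) (sqrt (1 - r\<^sup>2)) x * f (x, y) \<partial>lborel) \<partial>lborel)"
    by (intro nn_integral_cong nn_integral_cmult) measurable
  also have "\<dots> = (\<integral>\<^sup>+y. std_normal_density y * (\<integral>\<^sup>+w. std_normal_density w * f (r * y + sqrt (1 - r\<^sup>2) * w, y) \<partial>lborel) \<partial>lborel)"
    using pos by (subst nn_integral_normal_density_affine) auto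
  finally show ?thesis .
qed

lemma prob_space_bivariate_normal:
  assumes r: "\<bar>r\<bar> < 1"
  shows "prob_space (density lborel (bivariate_std_normal_density r))"
proof
  have "(\<integral>\<^sup>+x. std_normal_density x \<partial>lborel) = 1"
    using prob_space.emeasure_space_1[OF prob_space_normal_density[of 1 0]] by (simp add: emeasure_density)
  then have "(\<integral>\<^sup>+p. 1 \<partial>density lborel (bivariate_std_normal_density r)) = 1"
    using nn_integral_bivariate_normal[OF _ r, of "\<lambda>_. 1"] by simp
  then show "emeasure (density lborel (bivariate_std_normal_density r)) (space (density lborel (bivariate_std_normal_density r))) = 1"
    by simp
qed

context prob_space
begin

lemma indep_varI_prob:
  fixes X Z :: "'a \<Rightarrow> real"
  assumes [measurable]: "random_variable borel X" "random_variable borel Z"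
    and prod: "\<And>A B. A \<in> sets borel \<Longrightarrow> B \<in> sets borel \<Longrightarrow>
      prob ((X -` A \<inter> space M) \<inter> (Z -` B \<inter> space M)) = prob (X -` A \<inter> space M) * prob (Z -` B \<inter> space M)"
  shows "indep_var borel X borel Z"
proof -
  have Int_stable: "Int_stable {U -` A \<inter> space M | A. A \<in> sets borel}" for U :: "'a \<Rightarrow> real"
  proof (rule Int_stableI)
    fix a b assume "a \<in> {U -` A \<inter> space M | A. A \<in> sets borel}" "b \<in> {U -` A \<inter> space M | A. A \<in> sets borel}"
    then obtain A B where "A \<in> sets borel" "B \<in> sets borel" "a = U -` A \<inter> space M" "b = U -` B \<inter> space M" by auto
    then have "A \<inter> B \<in> sets borel" "a \<inter> b = U -` (A \<inter> B) \<inter> space M" by auto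
    then show "a \<inter> b \<in> {U -` A \<inter> space M | A. A \<in> sets borel}" by blast
  qed
  have "indep_set {X -` A \<inter> space M | A. A \<in> sets borel} {Z -` B \<inter> space M | B. B \<in> sets borel}"
    by (intro indep_setI) (auto simp: prod intro: measurable_sets[OF assms(1)] measurable_sets[OF assms(2)])
  then show ?thesis
    unfolding indep_var_eq using assms(1,2) by (auto intro!: indep_set_sigma_sets Int_stable)
qed

text \<open>Sklar's relation determines the joint distribution function, and the quadrants \<open>{..(a, b)}\<close> form an
  intersection-stable generator of the Borel sets of the plane.\<close>

lemma distr_pair_gaussian_copula:
  assumes X: "distributed M lborel X (normal_density 0 s)" and Z: "distributed M lborel Z (normal_density 0 v)"
    and s: "0 < s" and v: "0 < v" and r: "\<bar>r\<bar> < 1"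
    and cop: "has_copula X Z (gaussian_copula r)"
  shows "distr M borel (\<lambda>\<omega>. (X \<omega> / s, Z \<omega> / v)) = density lborel (bivariate_std_normal_density r)"
proof -
  have [measurable]: "random_variable borel X" "random_variable borel Z"
    using distributed_measurable[OF X] distributed_measurable[OF Z] by simp_all
  interpret B: prob_space "density lborel (bivariate_std_normal_density r)"
    by (rule prob_space_bivariate_normal[OF r])
  have [measurable]: "(\<lambda>\<omega>. (X \<omega> / s, Z \<omega> / v)) \<in> measurable M borel"
    unfolding borel_prod[symmetric] by measurable
  define E :: "(real \<times> real) set set" where "E = range atMost"
  have borel: "sets (borel :: (real \<times> real) measure) = sigma_sets UNIV E"
    unfolding E_def by (subst borel_eq_atMost) simp
  show ?thesis
  proof (rule measure_eqI_generator_eq[where E = E and \<Omega> = UNIV and A = "\<lambda>n::nat. {..(real n, real n)}"])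
    show "Int_stable E"
    proof (rule Int_stableI)
      fix A B assume "A \<in> E" "B \<in> E"
      then obtain a b where "A = {..a}" "B = {..b}" by (auto simp: E_def)
      then have "A \<inter> B = {..inf a b}" by auto
      then show "A \<inter> B \<in> E" by (simp add: E_def)
    qed
    show "emeasure (distr M borel (\<lambda>\<omega>. (X \<omega> / s, Z \<omega> / v))) C
      = emeasure (density lborel (bivariate_std_normal_density r)) C" if CE: "C \<in> E" for C
    proof -
      obtain a b where C: "C = {..(a, b)}" using CE by (force simp: E_def)
      have "emeasure (distr M borel (\<lambda>\<omega>. (X \<omega> / s, Z \<omega> / v))) C
          = prob ((\<lambda>\<omega>. (X \<omega> / s, Z \<omega> / v)) -` C \<inter> space M)"
        by (subst emeasure_distr) (simp_all add: C emeasure_eq_measure)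
      also have "(\<lambda>\<omega>. (X \<omega> / s, Z \<omega> / v)) -` C \<inter> space M
          = {\<omega> \<in> space M. X \<omega> \<le> a * s \<and> Z \<omega> \<le> b * v}"
        using s v by (auto simp: C pos_divide_le_eq)
      also have "prob \<dots> = gaussian_copula r (cdf std_normal_distribution a) (cdf std_normal_distribution b)"
        using cop s v by (simp add: has_copula_def cdf_distr_normal[OF X s] cdf_distr_normal[OF Z v])
      also have "\<dots> = B.prob {(x, y). x \<le> a \<and> y \<le> b}"
        by (simp add: gaussian_copula_def bivariate_std_normal_cdf_def std_normal_quantile_cdf)
      also have "{(x, y). x \<le> a \<and> y \<le> b} = C" by (auto simp: C)
      finally show ?thesis by (simp add: B.emeasure_eq_measure)
    qed
    show "(\<Union>n. {..(real n, real n)}) = UNIV"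
    proof (intro set_eqI iffI UNIV_I)
      fix p :: "real \<times> real"
      obtain n where "max (fst p) (snd p) \<le> real n" using real_arch_simple by blast
      then show "p \<in> (\<Union>n. {..(real n, real n)})" by (cases p) auto
    qed
    fix n :: nat
    show "emeasure (distr M borel (\<lambda>\<omega>. (X \<omega> / s, Z \<omega> / v))) {..(real n, real n)} \<noteq> \<infinity>"
      by (subst emeasure_distr) simp_all
  qed (auto simp: borel E_def)
qed

text \<open>In the coordinates \<open>(r * y + sqrt (1 - r\<^sup>2) * w, y)\<close> the residual \<open>e\<close> is exactly \<open>w\<close>, so the joint
  law of \<open>Z\<close> and \<open>e\<close> is a product.\<close>

lemma gaussian_copula_regression_residual:
  assumes X: "distributed M lborel X (normal_density 0 s)" and Z: "distributed M lborel Z (normal_density 0 v)"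
    and s: "0 < s" and v: "0 < v" and r: "\<bar>r\<bar> < 1"
    and cop: "has_copula X Z (gaussian_copula r)"
  defines "e \<equiv> \<lambda>\<omega>. (X \<omega> / s - r * (Z \<omega> / v)) / sqrt (1 - r\<^sup>2)"
  shows "distributed M lborel e std_normal_density" and "indep_var borel Z borel e"
proof -
  have [measurable]: "random_variable borel X" "random_variable borel Z"
    using distributed_measurable[OF X] distributed_measurable[OF Z] by simp_all
  have [measurable]: "random_variable borel e" unfolding e_def by measurable
  have pos: "0 < 1 - r\<^sup>2" using r by (simp add: abs_square_less_1)
  interpret N: prob_space std_normal_distribution by (rule prob_space_normal_density) simp
  have joint: "emeasure M {\<omega> \<in> space M. Z \<omega> \<in> A \<and> e \<omega> \<in> B}
      = emeasure M {\<omega> \<in> space M. Z \<omega> \<in> A} * emeasure std_normal_distribution B"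
    if [measurable]: "A \<in> sets borel" "B \<in> sets borel" for A B
  proof -
    \<comment> \<open>the product form with an unnamed first factor; taking \<open>B' = UNIV\<close> then identifies that factor\<close>
    have gen: "emeasure M {\<omega> \<in> space M. Z \<omega> \<in> A \<and> e \<omega> \<in> B'}
      = (\<integral>\<^sup>+y. ennreal (std_normal_density y) * indicator A (v * y) \<partial>lborel) * emeasure std_normal_distribution B'"
      if [measurable]: "B' \<in> sets borel" for B'
    proof -
      define f :: "real \<times> real \<Rightarrow> ennreal" where
        "f p = indicator A (v * snd p) * indicator B' ((fst p - r * snd p) / sqrt (1 - r\<^sup>2))" for p
      have [measurable]: "f \<in> borel_measurable borel"
        unfolding f_def borel_prod[symmetric] by measurable
      have [measurable]: "(\<lambda>\<omega>. (X \<omega> / s, Z \<omega> / v)) \<in> measurable M borel"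
        unfolding borel_prod[symmetric] by measurable
      have "emeasure M {\<omega> \<in> space M. Z \<omega> \<in> A \<and> e \<omega> \<in> B'}
          = (\<integral>\<^sup>+\<omega>. indicator {\<omega> \<in> space M. Z \<omega> \<in> A \<and> e \<omega> \<in> B'} \<omega> \<partial>M)"
        by (rule nn_integral_indicator[symmetric]) measurable
      also have "\<dots> = (\<integral>\<^sup>+\<omega>. f (X \<omega> / s, Z \<omega> / v) \<partial>M)"
        using v by (intro nn_integral_cong) (auto simp: f_def e_def split: split_indicator)
      also have "\<dots> = (\<integral>\<^sup>+p. f p \<partial>distr M borel (\<lambda>\<omega>. (X \<omega> / s, Z \<omega> / v)))"
        by (subst nn_integral_distr) auto
      also have "\<dots> = (\<integral>\<^sup>+y. std_normal_density y * (\<integral>\<^sup>+w. std_normal_density w * f (r * y + sqrt (1 - r\<^sup>2) * w, y) \<partial>lborel) \<partial>lborel)"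
        unfolding distr_pair_gaussian_copula[OF X Z s v r cop] using r by (subst nn_integral_bivariate_normal) auto
      also have "\<dots> = (\<integral>\<^sup>+y. (ennreal (std_normal_density y) * indicator A (v * y)) * emeasure std_normal_distribution B' \<partial>lborel)"
      proof (rule nn_integral_cong)
        fix y
        have "(\<integral>\<^sup>+w. std_normal_density w * f (r * y + sqrt (1 - r\<^sup>2) * w, y) \<partial>lborel)
            = (\<integral>\<^sup>+w. (indicator A (v * y) :: ennreal) * (ennreal (std_normal_density w) * indicator B' w) \<partial>lborel)"
          using pos by (intro nn_integral_cong) (auto simp: f_def split: split_indicator)
        also have "\<dots> = indicator A (v * y) * emeasure std_normal_distribution B'"
          by (subst nn_integral_cmult) (auto simp: emeasure_density)
        finally show "std_normal_density y * (\<integral>\<^sup>+w. std_normal_density w * f (r * y + sqrt (1 - r\<^sup>2) * w, y) \<partial>lborel)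
           = (ennreal (std_normal_density y) * indicator A (v * y)) * emeasure std_normal_distribution B'"
          by (simp add: mult.assoc)
      qed
      also have "\<dots> = (\<integral>\<^sup>+y. ennreal (std_normal_density y) * indicator A (v * y) \<partial>lborel) * emeasure std_normal_distribution B'"
        by (subst nn_integral_multc) auto
      finally show ?thesis .
    qed
    show ?thesis using gen[of B] gen[of UNIV] N.emeasure_space_1 by simp
  qed
  have law: "distr M lborel e = std_normal_distribution"
  proof (rule measure_eqI)
    fix B assume "B \<in> sets (distr M lborel e)"
    then have [measurable]: "B \<in> sets borel" by simp
    have "emeasure (distr M lborel e) B = emeasure M {\<omega> \<in> space M. Z \<omega> \<in> UNIV \<and> e \<omega> \<in> B}"
      by (subst emeasure_distr) (auto intro!: arg_cong2[where f=emeasure])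
    also have "\<dots> = emeasure std_normal_distribution B"
      by (subst joint) (auto simp: emeasure_space_1)
    finally show "emeasure (distr M lborel e) B = emeasure std_normal_distribution B" .
  qed simp
  then show "distributed M lborel e std_normal_density" by (simp add: distributed_def)
  have e_prob: "emeasure M {\<omega> \<in> space M. e \<omega> \<in> B} = emeasure std_normal_distribution B"
    if [measurable]: "B \<in> sets borel" for B
    using joint[of UNIV B] by (simp add: emeasure_space_1)
  show "indep_var borel Z borel e"
  proof (rule indep_varI_prob)
    fix A B :: "real set" assume [measurable]: "A \<in> sets borel" "B \<in> sets borel"
    have *: "Z -` A \<inter> space M = {\<omega> \<in> space M. Z \<omega> \<in> A}" "e -` B \<inter> space M = {\<omega> \<in> space M. e \<omega> \<in> B}"
      "{\<omega> \<in> space M. Z \<omega> \<in> A} \<inter> {\<omega> \<in> space M. e \<omega> \<in> B} = {\<omega> \<in> space M. Z \<omega> \<in> A \<and> e \<omega> \<in> B}"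
      by auto
    have "ennreal (prob {\<omega> \<in> space M. Z \<omega> \<in> A \<and> e \<omega> \<in> B})
      = ennreal (prob {\<omega> \<in> space M. Z \<omega> \<in> A} * prob {\<omega> \<in> space M. e \<omega> \<in> B})"
      using joint[of A B] e_prob[of B] by (simp add: emeasure_eq_measure ennreal_mult measure_nonneg)
    then show "prob (Z -` A \<inter> space M \<inter> (e -` B \<inter> space M)) = prob (Z -` A \<inter> space M) * prob (e -` B \<inter> space M)"
      unfolding * by (simp add: measure_nonneg)
  qed measurable
qed

text \<open>The case \<open>a = 0\<close> is separate because \<open>a * Z\<close> then has no density.\<close>

lemma normal_autoregression:
  assumes Z: "distributed M lborel Z (normal_density 0 v)" and e: "distributed M lborel e std_normal_density"
    and indep: "indep_var borel Z borel e" and v: "0 < v" and s: "0 < s"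
  shows "distributed M lborel (\<lambda>\<omega>. a * Z \<omega> + s * e \<omega>) (normal_density 0 (sqrt ((a * v)\<^sup>2 + s\<^sup>2)))"
proof (cases "a = 0")
  case True
  then show ?thesis using normal_density_affine[OF e _ , of s 0] s by simp
next
  case False
  have "indep_var borel ((\<lambda>x. a * x) \<circ> Z) borel ((\<lambda>x. s * x) \<circ> e)"
    using indep by (rule indep_var_compose) auto
  then have "indep_var borel (\<lambda>\<omega>. a * Z \<omega>) borel (\<lambda>\<omega>. s * e \<omega>)" by (simp add: comp_def)
  from add_indep_normal[OF this, of "\<bar>a\<bar> * v" s 0 0] show ?thesis
    using normal_density_affine[OF Z v False, of 0] normal_density_affine[OF e _ , of s 0] s v False
    by (simp add: power_mult_distrib)
qed

end

section \<open>The Markov property and the independence of innovations from the past\<close>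

context prob_space
begin

lemma indep_varI_subalgebra:
  fixes W e :: "'a \<Rightarrow> real"
  assumes F: "subalgebra M F" and W: "W \<in> borel_measurable F"
    and [measurable]: "random_variable borel e"
    and prod: "\<And>B C. B \<in> sets F \<Longrightarrow> C \<in> sets borel \<Longrightarrow>
      prob (B \<inter> (e -` C \<inter> space M)) = prob B * prob (e -` C \<inter> space M)"
  shows "indep_var borel W borel e"
proof -
  show ?thesis
  proof (rule indep_varI_prob)
    show "random_variable borel W" using measurable_from_subalg[OF F W] .
    fix A B :: "real set" assume AB: "A \<in> sets borel" "B \<in> sets borel"
    have "W -` A \<inter> space M \<in> sets F"
      using measurable_sets[OF W AB(1)] F by (simp add: subalgebra_def)
    with AB show "prob (W -` A \<inter> space M \<inter> (e -` B \<inter> space M)) = prob (W -` A \<inter> space M) * prob (e -` B \<inter> space M)"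
      by (intro prod)
  qed measurable
qed

lemma measurable_natural_filtration:
  assumes "s \<le> t"
  shows "Y s \<in> borel_measurable (natural_filtration M Y t)"
  unfolding natural_filtration_def using assms
  by (intro measurableI) (auto simp: space_measure_of_conv sets_measure_of_conv intro!: sigma_sets.Basic)

lemma subalgebra_natural_filtration:
  assumes [measurable]: "\<And>t. random_variable borel (Y t)"
  shows "subalgebra M (natural_filtration M Y t)"
proof -
  have gen: "(\<Union>s\<le>t. {Y s -` A \<inter> space M | A. A \<in> sets borel}) \<subseteq> events" by auto
  then have "sets (natural_filtration M Y t) \<subseteq> events"
    unfolding natural_filtration_def
    by (subst sets_measure_of) (use sets.space_closed in \<open>auto intro!: sets.sigma_sets_subset\<close>)
  then show ?thesis by (simp add: subalgebra_def natural_filtration_def space_measure_of_conv)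
qed

text \<open>Let \<open>F\<close> be the past up to \<open>t\<close> and \<open>G\<close> the \<open>\<sigma>\<close>-algebra of \<open>Y t\<close>. For an event \<open>B\<close> of the past
  let \<open>Z\<close> be its conditional probability given \<open>G\<close>. Conditional expectation is self-adjoint, so the
  Markov property says that \<open>B\<close> may be replaced by \<open>Z\<close> under the expectation with any event of the
  pair \<open>(Y t, Y (Suc t))\<close>. As \<open>e\<close> is a function of this pair and independent of \<open>Y t\<close>, hence of \<open>Z\<close>,
  the probability of \<open>B\<close> and \<open>e \<in> C\<close> is the expectation of \<open>Z\<close>, that is \<open>prob B\<close>, times the
  probability of \<open>e \<in> C\<close>.\<close>

lemma markov_innovation_indep_past:
  fixes Y :: "nat \<Rightarrow> 'a \<Rightarrow> real" and W e :: "'a \<Rightarrow> real"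
  assumes markov: "markov_process Y"
    and g [measurable]: "g \<in> borel_measurable (borel \<Otimes>\<^sub>M borel)"
    and e: "\<And>\<omega>. e \<omega> = g (Y t \<omega>, Y (Suc t) \<omega>)"
    and indep: "indep_var borel (Y t) borel e"
    and W: "W \<in> borel_measurable (natural_filtration M Y t)"
  shows "indep_var borel W borel e"
proof -
  have [measurable]: "\<And>t. random_variable borel (Y t)"
    using markov by (simp add: markov_process_def)
  have [measurable]: "random_variable borel e" unfolding e[abs_def] by measurable
  define F where "F = natural_filtration M Y t"
  define G where "G = vimage_algebra (space M) (Y t) borel"
  have sets_G: "sets G = {Y t -` A \<inter> space M | A. A \<in> sets borel}"
    unfolding G_def by (subst sets_vimage_algebra2) auto
  have subF: "subalgebra M F" unfolding F_def by (rule subalgebra_natural_filtration) measurable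
  have subG: "subalgebra M G"
    unfolding subalgebra_def by (auto simp: sets_G) (simp_all add: G_def)
  have Y_F: "Y t \<in> borel_measurable F" unfolding F_def by (rule measurable_natural_filtration) simp
  have Y_G [measurable]: "Y t \<in> borel_measurable G" unfolding G_def by (rule measurable_vimage_algebra1) simp
  have space_F: "space F = space M" using subF by (simp add: subalgebra_def)
  have G_F: "f \<in> borel_measurable F" if "f \<in> borel_measurable G" for f :: "'a \<Rightarrow> real"
  proof (rule measurable_from_subalg[OF _ that])
    show "subalgebra F G"
      using measurable_sets[OF Y_F] by (auto simp: subalgebra_def sets_G space_F) (simp_all add: G_def)
  qed
  interpret F: finite_measure_subalgebra M F by unfold_locales (rule subF)
  interpret G: finite_measure_subalgebra M G by unfold_locales (rule subG)
  show ?thesis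
  proof (rule indep_varI_subalgebra[OF subF])
    show "W \<in> borel_measurable F" using W by (simp add: F_def)
    fix B C assume B: "B \<in> sets F" and C [measurable]: "C \<in> sets (borel :: real measure)"
    have [measurable]: "B \<in> events" using B subF by (auto simp: subalgebra_def)
    define Z where "Z = real_cond_exp M G (indicator B)"
    have Z_G [measurable]: "Z \<in> borel_measurable G" unfolding Z_def by (rule borel_measurable_cond_exp)
    have Z_M [measurable]: "random_variable borel Z" using measurable_from_subalg[OF subG Z_G] .
    have int_B: "integrable M (indicat_real B)" by (intro integrable_const_bound[where B=1]) auto
    have Z_int: "integrable M Z" unfolding Z_def by (rule G.real_cond_exp_int[OF int_B])
    have Z_exp: "expectation Z = prob B" unfolding Z_def by (subst G.real_cond_exp_int[OF int_B]) simp
    have Z_nonneg: "AE \<omega> in M. 0 \<le> Z \<omega>" unfolding Z_def by (rule G.real_cond_exp_pos) auto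

    \<comment> \<open>the replacement of \<open>B\<close> by \<open>Z\<close> on rectangles; this is the step that uses the Markov property\<close>
    have rect: "(\<integral>\<omega>. indicator B \<omega> * (indicator A (Y t \<omega>) * indicator A' (Y (Suc t) \<omega>)) \<partial>M)
        = (\<integral>\<omega>. Z \<omega> * (indicator A (Y t \<omega>) * indicator A' (Y (Suc t) \<omega>)) \<partial>M)"
      if [measurable]: "A \<in> sets borel" "A' \<in> sets borel" for A A' :: "real set"
    proof -
      define h :: "'a \<Rightarrow> real" where "h \<omega> = indicator A' (Y (Suc t) \<omega>)" for \<omega>
      define k :: "'a \<Rightarrow> real" where "k \<omega> = indicator A (Y t \<omega>)" for \<omega>
      have hk: "0 \<le> h \<omega>" "h \<omega> \<le> 1" "0 \<le> k \<omega>" "k \<omega> \<le> 1" for \<omega> by (auto simp: h_def k_def)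
      have [measurable]: "random_variable borel h" unfolding h_def by measurable
      have k_G [measurable]: "k \<in> borel_measurable G" unfolding k_def by measurable
      have [measurable]: "random_variable borel k" using measurable_from_subalg[OF subG k_G] .
      have int_h: "integrable M h" unfolding h_def by (intro integrable_const_bound[where B=1]) auto
      have int_cond: "integrable M (real_cond_exp M G h)" by (rule G.real_cond_exp_int[OF int_h])
      have int1: "integrable M (\<lambda>\<omega>. (indicator B \<omega> * k \<omega>) * h \<omega>)"
        unfolding h_def k_def by (intro integrable_const_bound[where B=1]) (auto simp: indicator_def)
      have bounded_mult: "integrable M (\<lambda>\<omega>. f \<omega> * u \<omega>)"
        if "integrable M u" "random_variable borel f" "\<And>\<omega>. \<bar>f \<omega>\<bar> \<le> 1" for f u :: "'a \<Rightarrow> real"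
        by (rule Bochner_Integration.integrable_bound[OF that(1)])
          (use that in \<open>auto simp: abs_mult mult_left_le_one_le\<close>)
      have "(\<integral>\<omega>. indicator B \<omega> * (k \<omega> * h \<omega>) \<partial>M) = (\<integral>\<omega>. (indicator B \<omega> * k \<omega>) * h \<omega> \<partial>M)"
        by (simp add: mult.assoc)
      also have "\<dots> = (\<integral>\<omega>. (indicator B \<omega> * k \<omega>) * real_cond_exp M F h \<omega> \<partial>M)"
        using B G_F[OF k_G] by (intro F.real_cond_exp_intg(2)[symmetric] int1) (auto intro!: borel_measurable_times)
      also have "\<dots> = (\<integral>\<omega>. (k \<omega> * real_cond_exp M G h \<omega>) * indicator B \<omega> \<partial>M)"
      proof (rule integral_cong_AE)
        have "AE \<omega> in M. real_cond_exp M F h \<omega> = real_cond_exp M G h \<omega>"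
          using markov[unfolded markov_process_def, THEN conjunct2, rule_format, of t "Suc t" A'] that
          by (simp add: F_def G_def h_def[abs_def])
        then show "AE \<omega> in M. (indicator B \<omega> * k \<omega>) * real_cond_exp M F h \<omega>
            = (k \<omega> * real_cond_exp M G h \<omega>) * indicator B \<omega>"
          by eventually_elim simp
      qed measurable
      also have "\<dots> = (\<integral>\<omega>. (k \<omega> * real_cond_exp M G h \<omega>) * Z \<omega> \<partial>M)"
        unfolding Z_def
      proof (rule G.real_cond_exp_intg(2)[symmetric])
        show "integrable M (\<lambda>\<omega>. (k \<omega> * real_cond_exp M G h \<omega>) * indicator B \<omega>)"
          using bounded_mult[OF int_cond, of "\<lambda>\<omega>. k \<omega> * indicator B \<omega>"] hk
          by (simp add: mult_ac abs_mult) (auto simp: indicator_def)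
      qed auto
      also have "\<dots> = (\<integral>\<omega>. (k \<omega> * Z \<omega>) * real_cond_exp M G h \<omega> \<partial>M)" by (simp add: mult_ac)
      also have "\<dots> = (\<integral>\<omega>. (k \<omega> * Z \<omega>) * h \<omega> \<partial>M)"
      proof (rule G.real_cond_exp_intg(2))
        show "integrable M (\<lambda>\<omega>. (k \<omega> * Z \<omega>) * h \<omega>)"
          using bounded_mult[OF Z_int, of "\<lambda>\<omega>. k \<omega> * h \<omega>"] hk
          by (simp add: mult_ac abs_mult mult_le_one)
      qed auto
      also have "\<dots> = (\<integral>\<omega>. Z \<omega> * (k \<omega> * h \<omega>) \<partial>M)" by (simp add: mult_ac)
      finally show ?thesis by (simp only: h_def k_def)
    qed

    let ?P = "borel \<Otimes>\<^sub>M borel :: (real \<times> real) measure"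
    let ?\<mu> = "\<lambda>u :: 'a \<Rightarrow> real. distr (density M u) ?P (\<lambda>\<omega>. (Y t \<omega>, Y (Suc t) \<omega>))"
    have em: "emeasure (?\<mu> u) D = (\<integral>\<^sup>+\<omega>. ennreal (u \<omega>) * indicator D (Y t \<omega>, Y (Suc t) \<omega>) \<partial>M)"
      if [measurable]: "u \<in> borel_measurable M" "D \<in> sets ?P" for u :: "'a \<Rightarrow> real" and D
      by (subst emeasure_distr)
        (auto simp: emeasure_density intro!: nn_integral_cong split: split_indicator)
    have em_rect: "emeasure (?\<mu> u) (A \<times> A')
        = ennreal (\<integral>\<omega>. u \<omega> * (indicator A (Y t \<omega>) * indicator A' (Y (Suc t) \<omega>)) \<partial>M)"
      if "integrable M u" "AE \<omega> in M. 0 \<le> u \<omega>" and [measurable]: "A \<in> sets borel" "A' \<in> sets borel" for u A A'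
    proof -
      have [measurable]: "u \<in> borel_measurable M" using that by auto
      have "integrable M (\<lambda>\<omega>. u \<omega> * (indicator A (Y t \<omega>) * indicator A' (Y (Suc t) \<omega>)))"
        by (rule Bochner_Integration.integrable_bound[OF that(1)]) (auto simp: abs_mult indicator_def)
      then have "ennreal (\<integral>\<omega>. u \<omega> * (indicator A (Y t \<omega>) * indicator A' (Y (Suc t) \<omega>)) \<partial>M)
          = (\<integral>\<^sup>+\<omega>. ennreal (u \<omega> * (indicator A (Y t \<omega>) * indicator A' (Y (Suc t) \<omega>))) \<partial>M)"
        using that(2) by (intro nn_integral_eq_integral[symmetric]) auto
      also have "\<dots> = emeasure (?\<mu> u) (A \<times> A')"
        by (subst em) (auto intro!: nn_integral_cong split: split_indicator)
      finally show ?thesis by simp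
    qed
    \<comment> \<open>rectangles generate the product \<open>\<sigma>\<close>-algebra, so the replacement is valid for all events of the pair\<close>
    have law: "?\<mu> (indicator B) = ?\<mu> Z"
    proof (rule measure_eqI_generator_eq[where E = "{A \<times> A' | A A'. A \<in> sets borel \<and> A' \<in> sets borel}"
          and \<Omega> = UNIV and A = "\<lambda>_. UNIV \<times> UNIV"])
      show "Int_stable {A \<times> A' | A A'. A \<in> sets (borel :: real measure) \<and> A' \<in> sets (borel :: real measure)}"
        by (rule Int_stable_pair_measure_generator)
      fix D assume "D \<in> {A \<times> A' | A A'. A \<in> sets (borel :: real measure) \<and> A' \<in> sets (borel :: real measure)}"
      then obtain A A' where "D = A \<times> A'" and [simp]: "A \<in> sets borel" "A' \<in> sets borel" by auto
      then show "emeasure (?\<mu> (indicator B)) D = emeasure (?\<mu> Z) D"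
        using rect[of A A'] em_rect[OF int_B, of A A'] em_rect[OF Z_int Z_nonneg, of A A'] by simp
    next
      show "emeasure (?\<mu> (indicator B)) (UNIV \<times> UNIV) \<noteq> \<infinity>"
        using em_rect[OF int_B, of UNIV UNIV] by simp
    next
      show "range (\<lambda>_. UNIV \<times> UNIV) \<subseteq> {A \<times> A' | A A'. A \<in> sets (borel :: real measure) \<and> A' \<in> sets (borel :: real measure)}"
        unfolding image_subset_iff by (intro ballI CollectI exI[of _ UNIV] conjI) simp_all
    qed (simp_all add: sets_pair_measure)

    have [measurable]: "{p. g p \<in> C} \<in> sets ?P"
      using measurable_sets[OF g C] by (simp add: vimage_def space_pair_measure)
    have "indep_var borel Z borel e"
    proof (rule indep_varI_subalgebra[OF subG Z_G])
      fix B' C' assume "B' \<in> sets G" "C' \<in> sets (borel :: real measure)"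
      then obtain A where "A \<in> sets borel" "B' = Y t -` A \<inter> space M" by (auto simp: sets_G)
      moreover have "(Y t -` A \<inter> space M) \<inter> (e -` C' \<inter> space M) = (\<lambda>\<omega>. (Y t \<omega>, e \<omega>)) -` (A \<times> C') \<inter> space M"
        by auto
      ultimately show "prob (B' \<inter> (e -` C' \<inter> space M)) = prob B' * prob (e -` C' \<inter> space M)"
        using indep_varD[OF indep, of A C'] \<open>C' \<in> sets borel\<close> by simp
    qed measurable
    then have "indep_var borel ((\<lambda>x. x) \<circ> Z) borel ((indicator C :: real \<Rightarrow> real) \<circ> e)"
      by (rule indep_var_compose) auto
    then have Z_C: "indep_var borel Z borel (\<lambda>\<omega>. indicator C (e \<omega>) :: real)" by (simp add: comp_def)
    have int_C: "integrable M (\<lambda>\<omega>. indicator C (e \<omega>) :: real)"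
      by (intro integrable_const_bound[where B=1]) auto
    have exp_C: "expectation (\<lambda>\<omega>. indicat_real C (e \<omega>)) = prob (e -` C \<inter> space M)"
    proof -
      have "expectation (\<lambda>\<omega>. indicat_real C (e \<omega>)) = expectation (indicat_real (e -` C \<inter> space M))"
        by (intro Bochner_Integration.integral_cong) (auto split: split_indicator)
      then show ?thesis by simp
    qed
    have ZC_int: "integrable M (\<lambda>\<omega>. Z \<omega> * indicator C (e \<omega>))"
      by (rule indep_var_integrable[OF Z_C Z_int int_C])
    have "ennreal (prob (B \<inter> (e -` C \<inter> space M)))
        = (\<integral>\<^sup>+\<omega>. ennreal (indicator B \<omega>) * indicator {p. g p \<in> C} (Y t \<omega>, Y (Suc t) \<omega>) \<partial>M)"
    proof -
      have "ennreal (prob (B \<inter> (e -` C \<inter> space M)))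
          = (\<integral>\<^sup>+\<omega>. indicator (B \<inter> (e -` C \<inter> space M)) \<omega> \<partial>M)"
        unfolding emeasure_eq_measure[symmetric] by (rule nn_integral_indicator[symmetric]) measurable
      also have "\<dots> = (\<integral>\<^sup>+\<omega>. ennreal (indicator B \<omega>) * indicator {p. g p \<in> C} (Y t \<omega>, Y (Suc t) \<omega>) \<partial>M)"
        by (intro nn_integral_cong) (auto simp: e split: split_indicator)
      finally show ?thesis .
    qed
    also have "\<dots> = (\<integral>\<^sup>+\<omega>. ennreal (Z \<omega>) * indicator {p. g p \<in> C} (Y t \<omega>, Y (Suc t) \<omega>) \<partial>M)"
      using law by (simp flip: em)
    also have "\<dots> = (\<integral>\<^sup>+\<omega>. ennreal (Z \<omega> * indicator C (e \<omega>)) \<partial>M)"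
      by (intro nn_integral_cong) (auto simp: e split: split_indicator)
    also have "\<dots> = ennreal (\<integral>\<omega>. Z \<omega> * indicator C (e \<omega>) \<partial>M)"
      using Z_nonneg by (intro nn_integral_eq_integral ZC_int) auto
    also have "(\<integral>\<omega>. Z \<omega> * indicator C (e \<omega>) \<partial>M) = prob B * prob (e -` C \<inter> space M)"
      using indep_var_lebesgue_integral[OF Z_C Z_int int_C] by (simp add: Z_exp exp_C)
    finally show "prob (B \<inter> (e -` C \<inter> space M)) = prob B * prob (e -` C \<inter> space M)"
      by (simp add: measure_nonneg)
  qed measurable
qed

end

section \<open>Moments, almost sure equality and limits\<close>

lemma (in prob_space) distributed_normal_moments:
  assumes X: "distributed M lborel X (normal_density 0 v)" and v: "0 < v"
  shows "integrable M (\<lambda>\<omega>. X \<omega> ^ k)"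
    and "expectation X = 0" and "expectation (\<lambda>\<omega>. (X \<omega>)\<^sup>2) = v\<^sup>2" and "expectation (\<lambda>\<omega>. X \<omega> ^ 4) = 3 * v ^ 4"
proof -
  show "integrable M (\<lambda>\<omega>. X \<omega> ^ k)"
    using distributed_integrable[OF X, of "\<lambda>x. x ^ k"] integrable_normal_moment[OF v, of 0 k] by simp
  have moment: "expectation (\<lambda>\<omega>. X \<omega> ^ k) = (\<integral>x. normal_density 0 v x * x ^ k \<partial>lborel)" for k
    using distributed_integral[OF X, of "\<lambda>x. x ^ k"] by simp
  show "expectation X = 0"
    using moment[of 1] integral_normal_moment_nz_1[OF v, of 0] by simp
  show "expectation (\<lambda>\<omega>. (X \<omega>)\<^sup>2) = v\<^sup>2"
    using moment[of 2] integral_normal_moment_even[OF v, of 0 1] by simp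
  have "expectation (\<lambda>\<omega>. X \<omega> ^ 4) = fact 4 / ((2 / v\<^sup>2) ^ 2 * fact 2)"
    using moment[of 4] integral_normal_moment_even[OF v, of 0 2] by simp
  also have "\<dots> = 3 * v ^ 4"
    using v by (simp add: fact_numeral field_simps eval_nat_numeral)
  finally show "expectation (\<lambda>\<omega>. X \<omega> ^ 4) = 3 * v ^ 4" .
qed

lemma distributed_cong_AE:
  assumes X: "distributed M N X f" and "AE \<omega> in M. X \<omega> = X' \<omega>" and "X' \<in> measurable M N"
  shows "distributed M N X' f"
proof -
  have "distr M N X' = distr M N X"
    using assms distributed_measurable[OF X] by (intro distr_cong_AE) auto
  then show ?thesis using assms by (simp add: distributed_def)
qed

lemma (in prob_space) indep_var_cong_AE:
  assumes indep: "indep_var S X T Z" and eq: "AE \<omega> in M. Z \<omega> = Z' \<omega>" and Z': "random_variable T Z'"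
  shows "indep_var S X T Z'"
proof -
  have XZ: "random_variable S X" "random_variable T Z"
    using indep_var_rv1[OF indep] indep_var_rv2[OF indep] .
  have "distr M T Z' = distr M T Z"
    using XZ eq Z' by (intro distr_cong_AE) auto
  moreover have "distr M (S \<Otimes>\<^sub>M T) (\<lambda>\<omega>. (X \<omega>, Z' \<omega>)) = distr M (S \<Otimes>\<^sub>M T) (\<lambda>\<omega>. (X \<omega>, Z \<omega>))"
    using XZ eq Z' by (intro distr_cong_AE) auto
  ultimately show ?thesis
    using indep Z' unfolding indep_var_distribution_eq by simp
qed

text \<open>With \<open>\<epsilon> = \<bar>c - d\<bar> / 2\<close> the indicator of \<open>\<bar>X n - d\<bar> > \<epsilon>\<close> tends to \<open>1\<close> almost everywhere, so by
  dominated convergence the probability of this event tends to \<open>1\<close> and not to \<open>0\<close>.\<close>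

lemma not_converges_in_probability_of_AE_tendsto:
  assumes "prob_space M" and [measurable]: "\<And>n. X n \<in> borel_measurable M"
    and lim: "AE \<omega> in M. (\<lambda>n. X n \<omega>) \<longlonglongrightarrow> (c :: real)" and "c \<noteq> d"
  shows "\<not> converges_in_probability M X d"
proof
  interpret prob_space M by fact
  define \<epsilon> where "\<epsilon> = \<bar>c - d\<bar> / 2"
  have \<epsilon>: "0 < \<epsilon>" using \<open>c \<noteq> d\<close> by (simp add: \<epsilon>_def)
  assume "converges_in_probability M X d"
  then have "(\<lambda>n. prob {\<omega> \<in> space M. \<bar>X n \<omega> - d\<bar> > \<epsilon>}) \<longlonglongrightarrow> 0"
    using \<epsilon> by (simp add: converges_in_probability_def)
  moreover have "(\<lambda>n. prob {\<omega> \<in> space M. \<bar>X n \<omega> - d\<bar> > \<epsilon>}) \<longlonglongrightarrow> 1"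
  proof -
    have "(\<lambda>n. \<integral>\<omega>. indicator {\<omega> \<in> space M. \<bar>X n \<omega> - d\<bar> > \<epsilon>} \<omega> \<partial>M) \<longlonglongrightarrow> (\<integral>\<omega>. (1::real) \<partial>M)"
    proof (rule integral_dominated_convergence[where w = "\<lambda>_. 1"])
      from lim AE_space show "AE \<omega> in M. (\<lambda>n. indicator {\<omega> \<in> space M. \<bar>X n \<omega> - d\<bar> > \<epsilon>} \<omega>) \<longlonglongrightarrow> (1::real)"
      proof eventually_elim
        case (elim \<omega>)
        have "(\<lambda>n. \<bar>X n \<omega> - d\<bar>) \<longlonglongrightarrow> \<bar>c - d\<bar>" using elim by (intro tendsto_intros)
        then have "eventually (\<lambda>n. \<epsilon> < \<bar>X n \<omega> - d\<bar>) sequentially"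
          using \<epsilon> by (intro order_tendstoD(1)) (auto simp: \<epsilon>_def)
        then show ?case
          using elim by (intro tendsto_eventually) (auto elim!: eventually_mono)
      qed
    qed (auto intro!: AE_I2 simp: indicator_def)
    then show ?thesis by (simp add: prob_space)
  qed
  ultimately have "(0::real) = 1" by (rule LIMSEQ_unique)
  then show False by simp
qed

section \<open>The DIG-AR(1) process as an autoregression with varying coefficient\<close>

context DIG_AR1
begin

text \<open>The index is shifted by one: \<open>stdev n\<close> belongs to \<open>Y (Suc n)\<close>. The first coordinate \<open>Y 0 = 0\<close> is
  degenerate, so that \<open>Y 1 = \<xi> 1\<close> is the first one with a normal density.\<close>

primrec stdev :: "nat \<Rightarrow> real" where
  "stdev 0 = \<sigma>"
| "stdev (Suc n) = sqrt ((\<phi> * stdev n + \<rho> * \<sigma>)\<^sup>2 + \<sigma>\<^sup>2 * (1 - \<rho>\<^sup>2))"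

definition stdev_limit :: real where
  "stdev_limit = \<sigma> * (\<rho> * \<phi> + sqrt (\<rho>\<^sup>2 * \<phi>\<^sup>2 + 1 - \<phi>\<^sup>2)) / (1 - \<phi>\<^sup>2)"

definition noise :: real where "noise = \<sigma> * sqrt (1 - \<rho>\<^sup>2)"

definition coeff :: "nat \<Rightarrow> real" where "coeff n = \<phi> + \<rho> * \<sigma> / stdev n"

text \<open>The residual is written in terms of \<open>Y\<close> alone and not of \<open>\<xi>\<close>, so that it is measurable with respect
  to the natural filtration of \<open>Y\<close> everywhere, not merely up to null sets.\<close>

definition innov :: "nat \<Rightarrow> 'a \<Rightarrow> real" where
  "innov n \<omega> = (Y (Suc (Suc n)) \<omega> - coeff n * Y (Suc n) \<omega>) / noise"

lemma one_minus_squares_pos: "0 < 1 - \<rho>\<^sup>2" "0 < 1 - \<phi>\<^sup>2"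
  using rho phi by (simp_all add: abs_square_less_1)

lemma noise_pos: "0 < noise" and noise_square: "noise\<^sup>2 = \<sigma>\<^sup>2 * (1 - \<rho>\<^sup>2)"
  using one_minus_squares_pos sigma by (simp_all add: noise_def power_mult_distrib)

lemma stdev_pos: "0 < stdev n"
  using sigma one_minus_squares_pos by (cases n) (auto intro!: add_nonneg_pos)

lemma stdev_Suc_coeff: "stdev (Suc n) = sqrt ((coeff n * stdev n)\<^sup>2 + noise\<^sup>2)"
  using stdev_pos[of n] by (simp add: coeff_def noise_square distrib_right)

lemma stdev_limit_pos: "0 < stdev_limit"
proof -
  have "\<bar>\<rho> * \<phi>\<bar> < sqrt (\<rho>\<^sup>2 * \<phi>\<^sup>2 + 1 - \<phi>\<^sup>2)"
    using one_minus_squares_pos by (intro real_less_rsqrt) (simp add: power_mult_distrib)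
  then show ?thesis
    using sigma one_minus_squares_pos unfolding stdev_limit_def by (intro divide_pos_pos mult_pos_pos) auto
qed

text \<open>Squaring the equation gives a quadratic in \<open>stdev_limit\<close> whose positive root is the defining
  formula.\<close>

lemma stdev_limit_fixed_point:
  "stdev_limit = sqrt ((\<phi> * stdev_limit + \<rho> * \<sigma>)\<^sup>2 + \<sigma>\<^sup>2 * (1 - \<rho>\<^sup>2))"
proof -
  define d where "d = sqrt (\<rho>\<^sup>2 * \<phi>\<^sup>2 + 1 - \<phi>\<^sup>2)"
  have d: "d\<^sup>2 = \<rho>\<^sup>2 * \<phi>\<^sup>2 + 1 - \<phi>\<^sup>2"
  proof -
    have "0 \<le> \<rho>\<^sup>2 * \<phi>\<^sup>2" by simp
    then have "0 \<le> \<rho>\<^sup>2 * \<phi>\<^sup>2 + 1 - \<phi>\<^sup>2" using one_minus_squares_pos by linarith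
    then show ?thesis by (simp add: d_def)
  qed
  have L: "stdev_limit * (1 - \<phi>\<^sup>2) - \<sigma> * \<rho> * \<phi> = \<sigma> * d"
    using one_minus_squares_pos by (simp add: stdev_limit_def d_def field_simps)
  have "(stdev_limit * (1 - \<phi>\<^sup>2) - \<sigma> * \<rho> * \<phi>)\<^sup>2 = \<sigma>\<^sup>2 * (\<rho>\<^sup>2 * \<phi>\<^sup>2 + 1 - \<phi>\<^sup>2)"
    by (simp add: L power_mult_distrib d)
  then have "(1 - \<phi>\<^sup>2) * ((\<phi> * stdev_limit + \<rho> * \<sigma>)\<^sup>2 + \<sigma>\<^sup>2 * (1 - \<rho>\<^sup>2)) = (1 - \<phi>\<^sup>2) * stdev_limit\<^sup>2"
    by algebra
  then have "(\<phi> * stdev_limit + \<rho> * \<sigma>)\<^sup>2 + \<sigma>\<^sup>2 * (1 - \<rho>\<^sup>2) = stdev_limit\<^sup>2"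
    using one_minus_squares_pos by simp
  then show ?thesis using stdev_limit_pos by simp
qed

text \<open>The iterated map is \<open>v \<mapsto> norm (\<phi> * v + \<rho> * \<sigma>, noise)\<close> in the Euclidean plane, so the reverse
  triangle inequality shows that it contracts distances by \<open>\<bar>\<phi>\<bar>\<close>.\<close>

lemma stdev_tendsto: "stdev \<longlonglongrightarrow> stdev_limit"
proof -
  have contract: "\<bar>stdev (Suc n) - stdev_limit\<bar> \<le> \<bar>\<phi>\<bar> * \<bar>stdev n - stdev_limit\<bar>" for n
  proof -
    let ?f = "\<lambda>v. (\<phi> * v + \<rho> * \<sigma>, noise)"
    have f: "norm (?f v) = sqrt ((\<phi> * v + \<rho> * \<sigma>)\<^sup>2 + \<sigma>\<^sup>2 * (1 - \<rho>\<^sup>2))" for v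
      by (simp add: norm_Pair noise_square)
    have "\<bar>stdev (Suc n) - stdev_limit\<bar> = \<bar>norm (?f (stdev n)) - norm (?f stdev_limit)\<bar>"
      by (subst stdev_limit_fixed_point) (simp only: f stdev.simps)
    also have "\<dots> \<le> norm (?f (stdev n) - ?f stdev_limit)" by (rule norm_triangle_ineq3)
    also have "\<dots> = \<bar>\<phi> * (stdev n - stdev_limit)\<bar>" by (simp add: norm_Pair algebra_simps)
    finally show ?thesis by (simp add: abs_mult)
  qed
  have geo: "\<bar>stdev n - stdev_limit\<bar> \<le> \<bar>\<phi>\<bar> ^ n * \<bar>\<sigma> - stdev_limit\<bar>" for n
  proof (induction n)
    case (Suc n)
    have "\<bar>stdev (Suc n) - stdev_limit\<bar> \<le> \<bar>\<phi>\<bar> * (\<bar>\<phi>\<bar> ^ n * \<bar>\<sigma> - stdev_limit\<bar>)"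
      by (rule order_trans[OF contract mult_left_mono[OF Suc]]) simp
    then show ?case by simp
  qed simp
  have "(\<lambda>n. \<bar>\<phi>\<bar> ^ n * \<bar>\<sigma> - stdev_limit\<bar>) \<longlonglongrightarrow> 0"
    using phi by (intro tendsto_mult_left_zero LIMSEQ_power_zero) simp
  then have "(\<lambda>n. stdev n - stdev_limit) \<longlonglongrightarrow> 0"
    by (rule Lim_null_comparison[rotated]) (simp add: geo)
  then show ?thesis by (rule LIM_zero_cancel)
qed

lemma coeff_tendsto: "coeff \<longlonglongrightarrow> \<phi> + \<rho> * \<sigma> / stdev_limit"
  unfolding coeff_def[abs_def] using stdev_limit_pos by (intro tendsto_intros stdev_tendsto) auto

declare Y_measurable [measurable]

lemma innov_measurable [measurable]: "random_variable borel (innov n)"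
  unfolding innov_def[abs_def] by measurable

lemma Y_Suc_innov: "Y (Suc (Suc n)) \<omega> = coeff n * Y (Suc n) \<omega> + noise * innov n \<omega>"
  using noise_pos by (simp add: innov_def)

text \<open>Up to a null set \<open>innov n\<close> is the residual of the regression of \<open>\<xi> (n + 2)\<close> on \<open>Y (n + 1)\<close>.\<close>

lemma innov_of_normal:
  assumes "distributed M lborel (Y (Suc n)) (normal_density 0 (stdev n))"
  shows "distributed M lborel (innov n) std_normal_density" and "indep_var borel (Y (Suc n)) borel (innov n)"
proof -
  define e where "e \<omega> = (\<xi> (Suc (Suc n)) \<omega> / \<sigma> - \<rho> * (Y (Suc n) \<omega> / stdev n)) / sqrt (1 - \<rho>\<^sup>2)" for \<omega>
  have "has_copula (\<xi> (Suc (Suc n))) (Y (Suc n)) (gaussian_copula \<rho>)"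
    using copula[of "Suc (Suc n)"] by simp
  note res = gaussian_copula_regression_residual[OF innovation assms sigma stdev_pos rho this, folded e_def[abs_def]]
  have "AE \<omega> in M. Y (Suc (Suc n)) \<omega> = \<phi> * Y (Suc n) \<omega> + \<xi> (Suc (Suc n)) \<omega>"
    using Y_step[of "Suc (Suc n)"] by simp
  then have eq: "AE \<omega> in M. e \<omega> = innov n \<omega>"
  proof eventually_elim
    case (elim \<omega>)
    show ?case
      using sigma one_minus_squares_pos(1) stdev_pos[of n]
      by (simp add: elim e_def innov_def noise_def coeff_def field_simps)
  qed
  show "distributed M lborel (innov n) std_normal_density"
    by (rule distributed_cong_AE[OF res(1) eq]) auto
  show "indep_var borel (Y (Suc n)) borel (innov n)"
    by (rule indep_var_cong_AE[OF res(2) eq]) auto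
qed

text \<open>Normality propagates: it turns the copula condition into joint normality with the next innovation,
  which makes the next value an independent sum of normal variables.\<close>

lemma Y_normal: "distributed M lborel (Y (Suc n)) (normal_density 0 (stdev n))"
proof (induction n)
  case 0
  have "AE \<omega> in M. \<xi> 1 \<omega> = Y 1 \<omega>"
    using Y_step[of 1, OF order_refl] Y_0 by eventually_elim simp
  then show ?case
    using distributed_cong_AE[OF innovation[of 1]] by simp
next
  case (Suc n)
  have "Y (Suc (Suc n)) = (\<lambda>\<omega>. coeff n * Y (Suc n) \<omega> + noise * innov n \<omega>)"
    by (simp add: Y_Suc_innov[abs_def])
  then show ?case
    unfolding stdev_Suc_coeff
    using normal_autoregression[OF Suc innov_of_normal[OF Suc] stdev_pos noise_pos, of "coeff n"] by simp
qed

lemmas innov_normal = innov_of_normal(1)[OF Y_normal]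
  and innov_indep = innov_of_normal(2)[OF Y_normal]
  and Y_moments = distributed_normal_moments[OF Y_normal stdev_pos]
  and innov_moments = distributed_normal_moments[OF innov_of_normal(1)[OF Y_normal] zero_less_one]

lemma variance_Y: "variance (Y (Suc n)) = (stdev n)\<^sup>2"
  by (simp add: Y_moments)

lemma variance_Y_tendsto: "(\<lambda>t. sqrt (variance (Y t))) \<longlonglongrightarrow> stdev_limit"
proof -
  have "(\<lambda>n. sqrt (variance (Y (Suc n)))) = stdev"
    using stdev_pos by (simp only: variance_Y) (auto simp: less_imp_le)
  then show ?thesis
    using stdev_tendsto by (subst filterlim_sequentially_Suc[symmetric]) simp
qed

lemma correlation_Y:
  "correlation M (Y (Suc n)) (Y (Suc (Suc n))) = coeff n * stdev n / stdev (Suc n)"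
proof -
  have int: "integrable M (Y (Suc n))" "integrable M (innov n)"
    using Y_moments(1)[of n 1] innov_moments(1)[of n 1] by simp_all
  have "expectation (\<lambda>\<omega>. Y (Suc n) \<omega> * Y (Suc (Suc n)) \<omega>)
      = expectation (\<lambda>\<omega>. coeff n * (Y (Suc n) \<omega>)\<^sup>2 + noise * (Y (Suc n) \<omega> * innov n \<omega>))"
    by (simp add: Y_Suc_innov algebra_simps power2_eq_square)
  also have "\<dots> = coeff n * (stdev n)\<^sup>2"
    using indep_var_lebesgue_integral[OF innov_indep int] indep_var_integrable[OF innov_indep int]
    by (simp add: Y_moments innov_moments)
  finally show ?thesis
    unfolding correlation_def variance_Y
    using stdev_pos[of n] stdev_pos[of "Suc n"]
    by (simp add: Y_moments(2) power2_eq_square field_simps del: stdev.simps)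
qed

lemma correlation_Y_tendsto:
  "(\<lambda>t. correlation M (Y t) (Y (t + 1))) \<longlonglongrightarrow> \<phi> + \<rho> * \<sigma> / stdev_limit"
proof (subst filterlim_sequentially_Suc[symmetric])
  have "(\<lambda>n. coeff n * stdev n / stdev (Suc n)) \<longlonglongrightarrow> (\<phi> + \<rho> * \<sigma> / stdev_limit) * stdev_limit / stdev_limit"
    using stdev_limit_pos by (intro tendsto_intros coeff_tendsto stdev_tendsto LIMSEQ_Suc) auto
  then show "(\<lambda>n. correlation M (Y (Suc n)) (Y (Suc n + 1))) \<longlonglongrightarrow> \<phi> + \<rho> * \<sigma> / stdev_limit"
    using stdev_limit_pos by (simp add: correlation_Y del: stdev.simps)
qed

lemma ols_estimator_Suc:
  "ols_estimator Y (Suc N) \<omega>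
    = (\<Sum>n<N. Y (Suc (Suc n)) \<omega> * Y (Suc n) \<omega>) / (\<Sum>n<N. (Y (Suc n) \<omega>)\<^sup>2)"
proof -
  have reindex: "sum f {2..Suc N} = (\<Sum>n<N. f (Suc (Suc n)))" for f :: "nat \<Rightarrow> real"
    by (rule sum.reindex_bij_witness[of _ "\<lambda>n. Suc (Suc n)" "\<lambda>t. t - 2"]) (auto intro!: arg_cong[where f = f])
  show ?thesis unfolding ols_estimator_def reindex by simp
qed

lemma ols_estimator_measurable: "ols_estimator Y T \<in> borel_measurable M"
  unfolding ols_estimator_def[abs_def] by measurable

end

section \<open>Strong consistency for the limit of the correlations\<close>

context markov_DIG_AR1
begin

lemma innov_indep_past:
  assumes "W \<in> borel_measurable (natural_filtration M Y (Suc n))"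
  shows "indep_var borel W borel (innov n)"
proof (rule markov_innovation_indep_past[OF markov _ _ innov_indep assms])
  show "(\<lambda>(y, y'). (y' - coeff n * y) / noise) \<in> borel_measurable (borel \<Otimes>\<^sub>M borel)" by measurable
qed (simp add: innov_def)

text \<open>The inequality is strict for \<open>innov i\<close> because it involves \<open>Y (Suc (Suc i))\<close>.\<close>

lemma measurable_past:
  "i \<le> j \<Longrightarrow> Y (Suc i) \<in> borel_measurable (natural_filtration M Y (Suc j))"
  "i < j \<Longrightarrow> innov i \<in> borel_measurable (natural_filtration M Y (Suc j))"
proof -
  show Y: "Y (Suc i) \<in> borel_measurable (natural_filtration M Y (Suc j))" if "i \<le> j" for i
    using that by (intro measurable_natural_filtration) simp
  show "innov i \<in> borel_measurable (natural_filtration M Y (Suc j))" if "i < j"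
    unfolding innov_def[abs_def] using that
    by (intro borel_measurable_divide borel_measurable_diff borel_measurable_times borel_measurable_const Y) auto
qed

lemma innov_square_mean: "AE \<omega> in M. (\<lambda>N. (\<Sum>n<N. (innov n \<omega>)\<^sup>2 - 1) / real N) \<longlonglongrightarrow> 0"
proof (rule orthogonal_strong_law)
  have int: "integrable M (\<lambda>\<omega>. (innov i \<omega>)\<^sup>2 - 1)" for i
    using innov_moments(1)[of i 2] by simp
  have eq: "((innov i \<omega>)\<^sup>2 - 1)\<^sup>2 = innov i \<omega> ^ 4 - 2 * (innov i \<omega>)\<^sup>2 + 1" for i \<omega>
    by (simp add: power2_diff flip: power_mult)
  show "integrable M (\<lambda>\<omega>. ((innov i \<omega>)\<^sup>2 - 1)\<^sup>2)" for i
    unfolding eq using innov_moments(1)[of i 2] innov_moments(1)[of i 4] by simp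
  show "expectation (\<lambda>\<omega>. ((innov i \<omega>)\<^sup>2 - 1)\<^sup>2) \<le> 2" for i
    unfolding eq using innov_moments(1)[of i 2] innov_moments(1)[of i 4]
    by (simp add: innov_moments prob_space)
  fix i j :: nat assume "i < j"
  have "indep_var borel ((\<lambda>x. x\<^sup>2 - 1) \<circ> innov i) borel ((\<lambda>x. x\<^sup>2 - 1) \<circ> innov j)"
    using innov_indep_past[OF measurable_past(2)[OF \<open>i < j\<close>]] by (rule indep_var_compose) auto
  then have "indep_var borel (\<lambda>\<omega>. (innov i \<omega>)\<^sup>2 - 1) borel (\<lambda>\<omega>. (innov j \<omega>)\<^sup>2 - 1)"
    by (simp add: comp_def)
  from indep_var_lebesgue_integral[OF this int int]
  show "expectation (\<lambda>\<omega>. ((innov i \<omega>)\<^sup>2 - 1) * ((innov j \<omega>)\<^sup>2 - 1)) = 0"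
    using innov_moments(1)[of j 2] by (simp add: innov_moments prob_space)
qed measurable

text \<open>For \<open>i < j\<close> the product of the \<open>i\<close>-th and the \<open>j\<close>-th term is \<open>innov j\<close> times a variable from the past
  of time \<open>j + 1\<close>, so its expectation vanishes. The deterministic weights \<open>b\<close> cover both the noise
  term (\<open>b = 1\<close>) and the cross term in the growth of the sum of squares (\<open>b = coeff\<close>).\<close>

lemma innov_Y_mean:
  assumes b: "\<And>n. \<bar>b n\<bar> \<le> K"
  shows "AE \<omega> in M. (\<lambda>N. (\<Sum>n<N. b n * (innov n \<omega> * Y (Suc n) \<omega>)) / real N) \<longlonglongrightarrow> 0"
proof -
  obtain C where C: "\<And>n. \<bar>stdev n\<bar> \<le> C"
    using convergent_imp_Bseq[OF convergentI[OF stdev_tendsto]] by (auto simp: Bseq_def)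
  have "indep_var borel ((\<lambda>x. x\<^sup>2) \<circ> Y (Suc n)) borel ((\<lambda>x. x\<^sup>2) \<circ> innov n)" for n
    using innov_indep by (rule indep_var_compose) auto
  then have indep_sq: "indep_var borel (\<lambda>\<omega>. (Y (Suc n) \<omega>)\<^sup>2) borel (\<lambda>\<omega>. (innov n \<omega>)\<^sup>2)" for n
    by (simp add: comp_def)
  note int_sq = Y_moments(1)[of _ 2] innov_moments(1)[of _ 2]
  have prod_sq: "integrable M (\<lambda>\<omega>. (innov n \<omega> * Y (Suc n) \<omega>)\<^sup>2)"
    "expectation (\<lambda>\<omega>. (innov n \<omega> * Y (Suc n) \<omega>)\<^sup>2) = (stdev n)\<^sup>2" for n
    using indep_var_integrable[OF indep_sq int_sq] indep_var_lebesgue_integral[OF indep_sq int_sq]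
    by (simp_all add: power_mult_distrib mult.commute Y_moments innov_moments)
  show ?thesis
  proof (rule orthogonal_strong_law)
    show "integrable M (\<lambda>\<omega>. (b i * (innov i \<omega> * Y (Suc i) \<omega>))\<^sup>2)" for i
      unfolding power_mult_distrib[of "b i"] using prod_sq(1) by simp
    show "expectation (\<lambda>\<omega>. (b i * (innov i \<omega> * Y (Suc i) \<omega>))\<^sup>2) \<le> K\<^sup>2 * C\<^sup>2" for i
    proof -
      have "expectation (\<lambda>\<omega>. (b i * (innov i \<omega> * Y (Suc i) \<omega>))\<^sup>2) = (b i)\<^sup>2 * (stdev i)\<^sup>2"
        unfolding power_mult_distrib[of "b i"] using prod_sq by simp
      also have "\<dots> \<le> K\<^sup>2 * C\<^sup>2"
        using b[of i] C[of i] by (intro mult_mono) (auto simp: abs_le_square_iff[symmetric] intro: order_trans)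
      finally show ?thesis .
    qed
    fix i j :: nat assume "i < j"
    define W where "W \<omega> = innov i \<omega> * Y (Suc i) \<omega> * Y (Suc j) \<omega>" for \<omega>
    have "W \<in> borel_measurable (natural_filtration M Y (Suc j))"
      unfolding W_def[abs_def] using \<open>i < j\<close> by (intro borel_measurable_times measurable_past) auto
    then have indep: "indep_var borel W borel (innov j)" by (rule innov_indep_past)
    have "integrable M W"
      unfolding W_def[abs_def] by (intro integrable_mult_of_squares prod_sq int_sq) measurable
    moreover have "integrable M (innov j)" using innov_moments(1)[of j 1] by simp
    ultimately have "expectation (\<lambda>\<omega>. W \<omega> * innov j \<omega>) = 0"
      using indep_var_lebesgue_integral[OF indep] by (simp add: innov_moments)
    then have "expectation (\<lambda>\<omega>. b i * b j * (W \<omega> * innov j \<omega>)) = 0" by simp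
    then show "expectation (\<lambda>\<omega>. (b i * (innov i \<omega> * Y (Suc i) \<omega>)) * (b j * (innov j \<omega> * Y (Suc j) \<omega>))) = 0"
      by (simp add: W_def mult_ac)
  qed measurable
qed

lemma ols_estimator_AE_tendsto:
  "AE \<omega> in M. (\<lambda>T. ols_estimator Y T \<omega>) \<longlonglongrightarrow> \<phi> + \<rho> * \<sigma> / stdev_limit"
proof -
  obtain K where K: "\<And>n. \<bar>coeff n\<bar> \<le> K"
    using convergent_imp_Bseq[OF convergentI[OF coeff_tendsto]] by (auto simp: Bseq_def)
  have "AE \<omega> in M. (\<lambda>N. (\<Sum>n<N. 1 * (innov n \<omega> * Y (Suc n) \<omega>)) / real N) \<longlonglongrightarrow> 0"
    by (rule innov_Y_mean[where K = 1]) simp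
  with innov_Y_mean[of coeff, OF K] innov_square_mean show ?thesis
  proof eventually_elim
    case (elim \<omega>)
    have "(\<lambda>N. ols_estimator Y (Suc N) \<omega>) \<longlonglongrightarrow> \<phi> + \<rho> * \<sigma> / stdev_limit"
      unfolding ols_estimator_Suc
      using elim by (intro ols_ratio_tendsto[OF Y_Suc_innov noise_pos coeff_tendsto]) simp_all
    then show ?case by (subst (asm) filterlim_sequentially_Suc)
  qed
qed

end

theorem proposition4p1:
  fixes M :: "'a measure" and Y \<xi> :: "nat \<Rightarrow> 'a \<Rightarrow> real" and \<phi> \<rho> \<sigma> :: real
  assumes "\<bar>\<phi>\<bar> < 1" and "\<bar>\<rho>\<bar> < 1" and "\<sigma> > 0"
    and "markov_DIG_AR1 M Y \<xi> \<phi> \<rho> \<sigma>"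
  shows "let V = \<sigma> * (\<rho> * \<phi> + sqrt (\<rho>\<^sup>2 * \<phi>\<^sup>2 + 1 - \<phi>\<^sup>2)) / (1 - \<phi>\<^sup>2);
             \<tau> = \<phi> + \<rho> * \<sigma> / V
         in (\<lambda>t. sqrt (prob_space.variance M (Y t))) \<longlonglongrightarrow> V \<and>
            (\<lambda>t. correlation M (Y t) (Y (t + 1))) \<longlonglongrightarrow> \<tau> \<and>
            (AE \<omega> in M. (\<lambda>T. ols_estimator Y T \<omega>) \<longlonglongrightarrow> \<tau>) \<and>
            (\<rho> \<noteq> 0 \<longrightarrow> \<not> converges_in_probability M (ols_estimator Y) \<phi>)"
proof -
  interpret markov_DIG_AR1 M Y \<xi> \<phi> \<rho> \<sigma> by fact
  have "\<not> converges_in_probability M (ols_estimator Y) \<phi>" if "\<rho> \<noteq> 0"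
    using that sigma stdev_limit_pos
    by (intro not_converges_in_probability_of_AE_tendsto[OF prob_space_axioms ols_estimator_measurable
          ols_estimator_AE_tendsto]) auto
  then show ?thesis
    using variance_Y_tendsto correlation_Y_tendsto ols_estimator_AE_tendsto
    unfolding Let_def stdev_limit_def[symmetric] by blast
qed

end
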